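(* For every $\mathbf{a}\in l^{2}$ and $r\in\mathbb{N}$ one has $H^{r}\mathbf{a}=\mathcal{R}^{(r)}_{H}\mathbf{a}$. More explicitly, if $r=2s-1$ with $s\in\mathbb{N}$, then $$H^{2s-1}\mathbf{a}=\sum_{k\in\mathbb{Z}}(-1)^{k+1}A_{s,k}\,e^{(k-1/2)H}\mathbf{a},$$ and if $r=2s$ with $s\in\mathbb{N}$, then $$H^{2s}\mathbf{a}=\sum_{k\in\mathbb{Z}}(-1)^{k+1}B_{s,k}\,e^{kH}\mathbf{a}.$$
   Context: $\mathbb{N}=\{1,2,\dots\}$. $l^{2}$ is the Hilbert space of square-summable complex sequences $\mathbf{a}=(a_n)_{n\in\mathbb{Z}}$. $H:l^2\to l^2$ is the bounded operator $H=\pi\widetilde H$, where $\widetilde H$ is the discrete Hilbert transform; explicitly $(H\mathbf{a})_m=\sum_{n\in\mathbb{Z},\,n\neq m}\frac{a_n}{m-n}$, $m\in\mathbb{Z}$. For $t\in\mathbb{R}$, $e^{tH}=\sum_{k=0}^{\infty}\frac{t^kH^k}{k!}$. With $\mathrm{sinc}(t)=\frac{\sin(\pi t)}{\pi t}$, $\mathrm{sinc}(0)=1$, the coefficients are, for $s\in\mathbb{N}$, $$A_{s,k}=(-1)^{k+1}\mathrm{sinc}^{(2s-1)}\left(\tfrac12-k\right)=\frac{(2s-1)!}{\pi(k-\frac12)^{2s}}\sum_{j=0}^{s-1}\frac{(-1)^j}{(2j)!}\left(\pi\left(k-\tfrac12\right)\right)^{2j},\quad k\in\mathbb{Z},$$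 $$B_{s,k}=(-1)^{k+1}\mathrm{sinc}^{(2s)}(-k)=\frac{(2s)!}{\pi k^{2s+1}}\sum_{j=0}^{s-1}\frac{(-1)^j(\pi k)^{2j+1}}{(2j+1)!},\quad k\in\mathbb{Z}\setminus\{0\},\qquad B_{s,0}=(-1)^{s+1}\frac{\pi^{2s}}{2s+1}.$$ The operators $\mathcal{R}_H^{(r)}$ on $l^2$ are $\mathcal{R}^{(2s-1)}_{H}\mathbf{a}=\sum_{k\in\mathbb{Z}}(-1)^{k+1}A_{s,k}e^{(k-1/2)H}\mathbf{a}$ and $\mathcal{R}^{(2s)}_{H}\mathbf{a}=\sum_{k\in\mathbb{Z}}(-1)^{k+1}B_{s,k}e^{kH}\mathbf{a}$, the series converging in the norm of $l^2$. *)

theory Defs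
  imports "HOL-Analysis.Analysis"
begin

section \<open>The Hilbert space of square-summable complex sequences indexed by the integers\<close>

typedef l2 = "{a :: int \<Rightarrow> complex. (\<lambda>n. (cmod (a n))\<^sup>2) summable_on UNIV}"
  morphisms coord Abs_l2
  by (rule exI[of _ "\<lambda>_. 0"]) simp

setup_lifting type_definition_l2

lemma L2_set_le_infsum:
  assumes "(\<lambda>n. (cmod (a n))\<^sup>2) summable_on UNIV" "finite F"
  shows "L2_set (\<lambda>n. cmod (a n)) F \<le> sqrt (\<Sum>\<^sub>\<infinity>n. (cmod (a n))\<^sup>2)"
  unfolding L2_set_def
  by (rule real_sqrt_le_mono, rule finite_sum_le_infsum) (use assms in auto)

lemma square_summable_bound:
  fixes a :: "int \<Rightarrow> complex"
  assumes b: "\<And>F. finite F \<Longrightarrow> L2_set (\<lambda>n. cmod (a n)) F \<le> C"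
  shows "(\<lambda>n. (cmod (a n))\<^sup>2) summable_on UNIV" (is ?s)
    and "sqrt (\<Sum>\<^sub>\<infinity>n. (cmod (a n))\<^sup>2) \<le> C"
proof -
  have C0: "0 \<le> C" using b[of "{}"] by simp
  have f: "(\<Sum>n\<in>F. (cmod (a n))\<^sup>2) \<le> C\<^sup>2" if "finite F" for F
    using b[OF that] unfolding L2_set_def by (rule sqrt_le_D)
  show s: ?s
    by (rule nonneg_bdd_above_summable_on) (auto intro!: bdd_aboveI2[where M = "C\<^sup>2"] f)
  have "(\<Sum>\<^sub>\<infinity>n. (cmod (a n))\<^sup>2) \<le> C\<^sup>2"
    by (rule infsum_le_finite_sums[OF s]) (use f in auto)
  then show "sqrt (\<Sum>\<^sub>\<infinity>n. (cmod (a n))\<^sup>2) \<le> C"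
    using C0 by (simp add: real_le_lsqrt)
qed

lemma square_summable_add:
  fixes a b :: "int \<Rightarrow> complex"
  assumes "(\<lambda>n. (cmod (a n))\<^sup>2) summable_on UNIV" "(\<lambda>n. (cmod (b n))\<^sup>2) summable_on UNIV"
    and "finite F"
  shows "L2_set (\<lambda>n. cmod (a n + b n)) F
    \<le> sqrt (\<Sum>\<^sub>\<infinity>n. (cmod (a n))\<^sup>2) + sqrt (\<Sum>\<^sub>\<infinity>n. (cmod (b n))\<^sup>2)"
proof -
  have "L2_set (\<lambda>n. cmod (a n + b n)) F \<le> L2_set (\<lambda>n. cmod (a n) + cmod (b n)) F"
    by (rule L2_set_mono) (auto intro: norm_triangle_ineq)
  also have "\<dots> \<le> L2_set (\<lambda>n. cmod (a n)) F + L2_set (\<lambda>n. cmod (b n)) F"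
    by (rule L2_set_triangle_ineq)
  also have "\<dots> \<le> sqrt (\<Sum>\<^sub>\<infinity>n. (cmod (a n))\<^sup>2) + sqrt (\<Sum>\<^sub>\<infinity>n. (cmod (b n))\<^sup>2)"
    by (intro add_mono L2_set_le_infsum assms)
  finally show ?thesis .
qed

instantiation l2 :: real_normed_vector
begin

lift_definition zero_l2 :: l2 is "\<lambda>_. 0" by simp
lift_definition plus_l2 :: "l2 \<Rightarrow> l2 \<Rightarrow> l2" is "\<lambda>a b n. a n + b n"
  by (rule square_summable_bound(1), rule square_summable_add)
lift_definition uminus_l2 :: "l2 \<Rightarrow> l2" is "\<lambda>a n. - a n" by simp
lift_definition minus_l2 :: "l2 \<Rightarrow> l2 \<Rightarrow> l2" is "\<lambda>a b n. a n - b n"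
  using square_summable_bound(1)[OF square_summable_add, of _ "\<lambda>n. - _ n"] by simp
lift_definition scaleR_l2 :: "real \<Rightarrow> l2 \<Rightarrow> l2" is "\<lambda>c a n. c *\<^sub>R a n"
  by (simp add: power_mult_distrib summable_on_cmult_right)
lift_definition norm_l2 :: "l2 \<Rightarrow> real" is "\<lambda>a. sqrt (\<Sum>\<^sub>\<infinity>n. (cmod (a n))\<^sup>2)" .

definition dist_l2 :: "l2 \<Rightarrow> l2 \<Rightarrow> real" where "dist_l2 x y = norm (x - y)"
definition sgn_l2 :: "l2 \<Rightarrow> l2" where "sgn_l2 x = scaleR (inverse (norm x)) x"
definition uniformity_l2 :: "(l2 \<times> l2) filter"
  where "uniformity_l2 = (INF e\<in>{0<..}. principal {(x, y). dist x y < e})"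
definition open_l2 :: "l2 set \<Rightarrow> bool"
  where "open_l2 S = (\<forall>x\<in>S. \<forall>\<^sub>F (x', y) in uniformity. x' = x \<longrightarrow> y \<in> S)"

instance
proof
  fix x y z :: l2 and c d :: real
  show "x + y + z = x + (y + z)" by transfer (simp add: add.assoc)
  show "x + y = y + x" by transfer (simp add: add.commute)
  show "0 + x = x" by transfer simp
  show "- x + x = 0" by transfer simp
  show "x - y = x + - y" by transfer simp
  show "c *\<^sub>R (x + y) = c *\<^sub>R x + c *\<^sub>R y" by transfer (simp add: scaleR_add_right)
  show "(c + d) *\<^sub>R x = c *\<^sub>R x + d *\<^sub>R x" by transfer (simp add: scaleR_add_left)
  show "c *\<^sub>R d *\<^sub>R x = (c * d) *\<^sub>R x" by transfer simp
  show "1 *\<^sub>R x = x" by transfer simp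
  show "dist x y = norm (x - y)" by (simp add: dist_l2_def)
  show "sgn x = inverse (norm x) *\<^sub>R x" by (simp add: sgn_l2_def)
  show "(uniformity :: (l2 \<times> l2) filter) = (INF e\<in>{0<..}. principal {(x, y). dist x y < e})"
    by (simp add: uniformity_l2_def)
  show "open U = (\<forall>x\<in>U. \<forall>\<^sub>F (x', y) in uniformity. x' = x \<longrightarrow> y \<in> U)" for U :: "l2 set"
    by (simp add: open_l2_def)
  show "norm x = 0 \<longleftrightarrow> x = 0"
  proof
    assume "norm x = 0"
    then show "x = 0"
    proof transfer
      fix a :: "int \<Rightarrow> complex"
      assume s: "(\<lambda>n. (cmod (a n))\<^sup>2) summable_on UNIV" and "sqrt (\<Sum>\<^sub>\<infinity>n. (cmod (a n))\<^sup>2) = 0"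
      then have "L2_set (\<lambda>n. cmod (a n)) {n} \<le> 0" for n
        using L2_set_le_infsum[OF s, of "{n}"] by simp
      then show "a = (\<lambda>_. 0)" by (auto simp: L2_set_def)
    qed
  next
    assume "x = 0" then show "norm x = 0" by (simp, transfer) simp
  qed
  show "norm (x + y) \<le> norm x + norm y"
    by transfer (rule square_summable_bound(2), rule square_summable_add)
  show "norm (c *\<^sub>R x) = \<bar>c\<bar> * norm x"
    by transfer (simp add: power_mult_distrib infsum_cmult_right real_sqrt_mult)
qed

end

lemma norm_l2_le:
  assumes "\<And>F. finite F \<Longrightarrow> L2_set (\<lambda>n. cmod (coord x n)) F \<le> C"
  shows "norm x \<le> C"
  unfolding norm_l2.rep_eq by (rule square_summable_bound(2)) (rule assms)

lemma L2_set_le_norm_l2: "finite F \<Longrightarrow> L2_set (\<lambda>n. cmod (coord x n)) F \<le> norm x"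
  unfolding norm_l2.rep_eq by (rule L2_set_le_infsum) (use coord[of x] in auto)

lemma cmod_coord_le_norm: "cmod (coord x n) \<le> norm x"
  using L2_set_le_norm_l2[of "{n}" x] by (simp add: L2_set_def)

instance l2 :: banach
proof
  fix X :: "nat \<Rightarrow> l2"
  assume "Cauchy X"
  have "Cauchy (\<lambda>i. coord (X i) n)" for n
  proof (rule metric_CauchyI)
    fix e :: real assume "0 < e"
    then obtain M where M: "\<And>i j. i \<ge> M \<Longrightarrow> j \<ge> M \<Longrightarrow> dist (X i) (X j) < e"
      using metric_CauchyD[OF \<open>Cauchy X\<close>] by blast
    have "dist (coord (X i) n) (coord (X j) n) \<le> dist (X i) (X j)" for i j
      using cmod_coord_le_norm[of "X i - X j" n] by (simp add: dist_norm minus_l2.rep_eq)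
    then show "\<exists>M. \<forall>i\<ge>M. \<forall>j\<ge>M. dist (coord (X i) n) (coord (X j) n) < e"
      using M by (meson le_less_trans)
  qed
  then have "\<forall>n. \<exists>l. (\<lambda>i. coord (X i) n) \<longlonglongrightarrow> l"
    by (simp add: Cauchy_convergent_iff convergent_def)
  then obtain y where y: "\<And>n. (\<lambda>i. coord (X i) n) \<longlonglongrightarrow> y n"
    using choice[of "\<lambda>n l. (\<lambda>i. coord (X i) n) \<longlonglongrightarrow> l"] by blast
  have key: "\<exists>M. \<forall>i\<ge>M. \<forall>F. finite F \<longrightarrow> L2_set (\<lambda>n. cmod (coord (X i) n - y n)) F \<le> e"
    if e: "0 < e" for e
  proof -
    obtain M where M: "\<And>i j. i \<ge> M \<Longrightarrow> j \<ge> M \<Longrightarrow> dist (X i) (X j) < e"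
      using metric_CauchyD[OF \<open>Cauchy X\<close> e] by blast
    have "L2_set (\<lambda>n. cmod (coord (X i) n - y n)) F \<le> e" if i: "i \<ge> M" and F: "finite F" for i F
    proof (rule LIMSEQ_le_const2)
      show "(\<lambda>j. L2_set (\<lambda>n. cmod (coord (X i) n - coord (X j) n)) F)
          \<longlonglongrightarrow> L2_set (\<lambda>n. cmod (coord (X i) n - y n)) F"
        unfolding L2_set_def by (intro tendsto_intros y)
      show "\<exists>N. \<forall>j\<ge>N. L2_set (\<lambda>n. cmod (coord (X i) n - coord (X j) n)) F \<le> e"
      proof (intro exI[of _ M] allI impI)
        fix j assume "j \<ge> M"
        with M[OF i] have "norm (X i - X j) < e" by (simp add: dist_norm)
        with L2_set_le_norm_l2[OF F, of "X i - X j"]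
        show "L2_set (\<lambda>n. cmod (coord (X i) n - coord (X j) n)) F \<le> e"
          by (simp add: minus_l2.rep_eq)
      qed
    qed
    then show ?thesis by blast
  qed
  obtain M where M: "\<And>F. finite F \<Longrightarrow> L2_set (\<lambda>n. cmod (coord (X M) n - y n)) F \<le> 1"
    using key[of 1] by auto
  define d where "d = Abs_l2 (\<lambda>n. coord (X M) n - y n)"
  have d: "coord d n = coord (X M) n - y n" for n
    unfolding d_def by (subst Abs_l2_inverse) (use square_summable_bound(1)[OF M] in auto)
  define z where "z = X M - d"
  have z: "coord z n = y n" for n by (simp add: z_def minus_l2.rep_eq d)
  have "X \<longlonglongrightarrow> z"
  proof (rule metric_LIMSEQ_I)
    fix r :: real assume "0 < r"
    then obtain N where N: "\<And>i F. i \<ge> N \<Longrightarrow> finite F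
        \<Longrightarrow> L2_set (\<lambda>n. cmod (coord (X i) n - y n)) F \<le> r / 2"
      using key[of "r / 2"] by auto
    have "norm (X i - z) \<le> r / 2" if "i \<ge> N" for i
      by (rule norm_l2_le) (use N[OF that] in \<open>simp add: minus_l2.rep_eq z\<close>)
    then show "\<exists>N. \<forall>i\<ge>N. dist (X i) z < r"
      using \<open>0 < r\<close> by (intro exI[of _ N]) (fastforce simp: dist_norm)
  qed
  then show "convergent X" by (auto simp: convergent_def)
qed


section \<open>The operator \<open>H\<close> and the operators \<open>e\<^sup>t\<^sup>H\<close>\<close>

text \<open>
  Bounded operators are elements of \<^typ>\<open>l2 \<Rightarrow>\<^sub>L l2\<close>, so only real-linearity is recorded in the
  type. By Hilbert's inequality the sequence below is square-summable for every \<open>a\<close>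
  and \<open>\<parallel>H a\<parallel> \<le> \<pi> \<parallel>a\<parallel>\<close>, so both \<^const>\<open>Abs_l2\<close> and \<^const>\<open>Blinfun\<close> are applied inside
  their domains.
\<close>
definition H :: "l2 \<Rightarrow>\<^sub>L l2" where
  "H = Blinfun (\<lambda>a. Abs_l2 (\<lambda>m. \<Sum>\<^sub>\<infinity>n\<in>-{m}. coord a n / of_int (m - n)))"

primrec blinfun_power :: "('a::real_normed_vector \<Rightarrow>\<^sub>L 'a) \<Rightarrow> nat \<Rightarrow> 'a \<Rightarrow>\<^sub>L 'a" where
  "blinfun_power T 0 = id_blinfun"
| "blinfun_power T (Suc n) = T o\<^sub>L blinfun_power T n"

definition exp_H :: "real \<Rightarrow> l2 \<Rightarrow>\<^sub>L l2" where
  "exp_H t = (\<Sum>k. (t ^ k / fact k) *\<^sub>R blinfun_power H k)"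


section \<open>The coefficients and the operators \<open>\<R>\<^sub>H\<close>\<close>

definition sinc :: "real \<Rightarrow> real" where
  "sinc t = (if t = 0 then 1 else sin (pi * t) / (pi * t))"

definition coeff_A :: "nat \<Rightarrow> int \<Rightarrow> real" where
  "coeff_A s k = (-1) powi (k + 1) * (deriv ^^ (2 * s - 1)) sinc (1 / 2 - real_of_int k)"

definition coeff_B :: "nat \<Rightarrow> int \<Rightarrow> real" where
  "coeff_B s k = (-1) powi (k + 1) * (deriv ^^ (2 * s)) sinc (- real_of_int k)"

text \<open>
  \<open>R_H r\<close> is only meant for \<open>r \<ge> 1\<close>; for odd \<open>r = 2 s - 1\<close> one has \<open>s = (r + 1) div 2\<close>.
\<close>
definition R_H :: "nat \<Rightarrow> l2 \<Rightarrow> l2" where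
  "R_H r a =
    (if odd r
     then \<Sum>\<^sub>\<infinity>k\<in>UNIV. ((-1) powi (k + 1) * coeff_A ((r + 1) div 2) k) *\<^sub>R
            blinfun_apply (exp_H (real_of_int k - 1 / 2)) a
     else \<Sum>\<^sub>\<infinity>k\<in>UNIV. ((-1) powi (k + 1) * coeff_B (r div 2) k) *\<^sub>R
            blinfun_apply (exp_H (real_of_int k)) a)"

end

theory Submission
  imports Defs
begin

text \<open>
  If a sequence \<open>a\<close> is pictured as the function \<open>\<Sum>n. a\<^sub>n e\<^bsup>-inx\<^esup>\<close> on \<open>[0, 2\<pi>]\<close>, then \<^const>\<open>H\<close> is
  multiplication by \<open>\<i> (x - \<pi>)\<close>, because the mean of \<open>\<i> (x - \<pi>) e\<^bsup>ijx\<^esup>\<close> is \<open>1 / j\<close>. Hence \<open>e\<^sup>t\<^sup>H\<close> is multiplication by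
  \<open>exp (\<i> t (x - \<pi>))\<close>, and its matrix entry at \<open>(m, n)\<close> is \<open>(-1)\<^sup>j sinc (t + j)\<close> with \<open>j = m - n\<close>.
  Two consequences carry the whole argument. Since \<open>sinc\<close> vanishes at the nonzero integers,
  \<open>e\<^sup>k\<^sup>H\<close> is, for an integer \<open>k\<close>, a translation by \<open>k\<close> up to the sign \<open>(-1)\<^sup>k\<close>
  (\<open>exp_int_H_endo\<close>). Differentiating \<open>r\<close> times in \<open>t\<close>, the operator \<open>H\<^sup>r e\<^sup>t\<^sup>H\<close> has the entries
  \<open>(-1)\<^sup>j sinc\<^bsup>(r)\<^esup> (t + j)\<close> (\<open>coord_H_endo_power_exp_delta0\<close>).

  An operator whose entries depend only on \<open>j = m - n\<close>, in an absolutely summable way, is a norm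
  convergent series of translations. Reading off the coefficients gives
  \<open>H\<^sup>r e\<^sup>t\<^sup>H = (\<Sum>k. sinc\<^bsup>(r)\<^esup> (t - k) e\<^sup>k\<^sup>H)\<close>, and multiplication by \<open>e\<^bsup>-tH\<^esup>\<close> yields
  \<open>H\<^sup>r = (\<Sum>k. sinc\<^bsup>(r)\<^esup> (t - k) e\<^bsup>(k-t)H\<^esup>)\<close> (\<open>H_endo_power_has_sum\<close>). The two claimed formulas are
  the cases \<open>t = 1/2\<close> with \<open>r\<close> odd and \<open>t = 0\<close> with \<open>r\<close> even.

  These choices of \<open>t\<close> make the coefficients absolutely summable. Differentiating
  \<open>x sinc x = sin (\<pi> x) / \<pi>\<close> shows that \<open>x sinc\<^bsup>(r)\<^esup> x + r sinc\<^bsup>(r-1)\<^esup> x\<close> is a constant times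
  \<open>sin (\<pi> x + r \<pi> / 2)\<close>, which vanishes at all nodes \<open>x = t - k\<close> exactly when \<open>t + r / 2\<close> is an
  integer. At the nonzero nodes \<open>sinc\<^bsup>(r)\<^esup> x = - r sinc\<^bsup>(r-1)\<^esup> x / x\<close> is therefore a product of two
  square-summable sequences (\<open>derivs_sinc_abs_summable\<close>); the first one is square-summable because it is, up to signs, the
  sequence \<open>H\<^bsup>r-1\<^esup> e\<^sup>t\<^sup>H \<delta>\<^sub>0\<close>.

  No identification of \<open>l\<^sup>2\<close> with \<open>L\<^sup>2\<close> is made. Bessel's identity for continuous functions gives
  both the boundedness of \<^const>\<open>H\<close> (\<open>hilbert_inequality\<close>) and, together with
  \<open>(\<Sum>n\<ge>1. 1 / n\<^sup>2) = \<pi>\<^sup>2 / 6\<close>, the mean square convergence of the Fourier series of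
  \<open>\<i> (x - \<pi>)\<close>. From the latter follows the integral formula for \<open>H\<^sup>k \<delta>\<^sub>0\<close>
  (\<open>coord_H_power_delta0\<close>), hence the formula for \<open>e\<^sup>t\<^sup>H \<delta>\<^sub>0\<close>. All operators in play commute with
  translations and with complex scalars, so they are determined by their value at \<open>\<delta>\<^sub>0\<close>
  (\<open>shift_commutant_eqI\<close>).
\<close>

section \<open>Mean values over a period and Bessel's identity\<close>

definition mean :: "(real \<Rightarrow> 'a::real_normed_vector) \<Rightarrow> 'a" where
  "mean f = integral {0..2 * pi} f /\<^sub>R (2 * pi)"

abbreviation period :: "real set" where "period \<equiv> {0..2 * pi}"

lemma mean_add:
  fixes f g :: "real \<Rightarrow> 'a::banach"
  assumes "continuous_on period f" "continuous_on period g"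
  shows "mean (\<lambda>x. f x + g x) = mean f + mean g"
  using assms by (simp add: mean_def integral_add integrable_continuous_real scaleR_add_right)

lemma mean_diff:
  fixes f g :: "real \<Rightarrow> 'a::banach"
  assumes "continuous_on period f" "continuous_on period g"
  shows "mean (\<lambda>x. f x - g x) = mean f - mean g"
  using assms by (simp add: mean_def integral_diff integrable_continuous_real scaleR_diff_right)

lemma mean_sum:
  fixes f :: "'b \<Rightarrow> real \<Rightarrow> 'a::banach"
  assumes "finite A" "\<And>i. i \<in> A \<Longrightarrow> continuous_on period (f i)"
  shows "mean (\<lambda>x. \<Sum>i\<in>A. f i x) = (\<Sum>i\<in>A. mean (f i))"
  using assms by (simp add: mean_def integral_sum integrable_continuous_real scaleR_sum_right)

lemma mean_linear:
  fixes f :: "real \<Rightarrow> 'a::banach" and h :: "'a \<Rightarrow> 'b::banach"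
  assumes "continuous_on period f" "bounded_linear h"
  shows "mean (\<lambda>x. h (f x)) = h (mean f)"
  using integral_linear[OF integrable_continuous_real[OF assms(1)] assms(2)]
  by (simp add: mean_def o_def linear_cmul[OF bounded_linear.linear[OF assms(2)]])

lemma mean_mult_right:
  fixes f :: "real \<Rightarrow> 'a::{real_normed_algebra,banach}"
  assumes "continuous_on period f"
  shows "mean (\<lambda>x. c * f x) = c * mean f"
  by (rule mean_linear[OF assms bounded_linear_mult_right])

lemma mean_const: "mean (\<lambda>x. c :: 'a::banach) = c"
  by (simp add: mean_def)

lemma mean_mono:
  fixes f g :: "real \<Rightarrow> real"
  assumes "continuous_on period f" "continuous_on period g" "\<And>x. x \<in> period \<Longrightarrow> f x \<le> g x"
  shows "mean f \<le> mean g"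
  unfolding mean_def real_scaleR_def
  by (intro mult_left_mono integral_le integrable_continuous_real assms) auto

lemma mean_eqI:
  assumes "(f has_integral c) period"
  shows "mean f = c /\<^sub>R (2 * pi)"
  using assms by (simp add: mean_def integral_unique)

lemma has_vector_derivative_cis_mult:
  "((\<lambda>x. cis (c * x)) has_vector_derivative \<i> * of_real c * cis (c * x)) (at x within S)"
  unfolding cis_conv_exp of_real_mult
  by (rule has_vector_derivative_real_field[where f = "\<lambda>z. exp (\<i> * (of_real c * z))"])
    (auto intro!: derivative_eq_intros)

lemma mean_cis: "mean (\<lambda>x. cis (of_int n * x)) = (if n = 0 then 1 else 0)"
proof (cases "n = 0")
  case False
  have "((\<lambda>x. cis (of_int n * x)) has_integral
      cis (of_int n * (2 * pi)) / (\<i> * of_int n) - cis (of_int n * 0) / (\<i> * of_int n)) period"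
    by (rule fundamental_theorem_of_calculus)
      (use False in \<open>auto intro!: derivative_eq_intros has_vector_derivative_cis_mult\<close>)
  moreover have "cis (of_int n * (2 * pi)) = 1"
    using cis_multiple_2pi[of "of_int n"] by (simp add: mult.commute)
  ultimately show ?thesis using False by (simp add: mean_def integral_unique)
qed (simp add: mean_const)

definition fourier_coeff :: "(real \<Rightarrow> complex) \<Rightarrow> int \<Rightarrow> complex" where
  "fourier_coeff f n = mean (\<lambda>x. f x * cis (- (of_int n * x)))"

lemma fourier_coeff_trig_poly:
  assumes "finite F"
  shows "fourier_coeff (\<lambda>x. \<Sum>n\<in>F. c n * cis (of_int n * x)) m = (if m \<in> F then c m else 0)"
proof -
  have "fourier_coeff (\<lambda>x. \<Sum>n\<in>F. c n * cis (of_int n * x)) m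
      = mean (\<lambda>x. \<Sum>n\<in>F. c n * cis (of_int (n - m) * x))"
    by (simp add: fourier_coeff_def sum_distrib_right mult.assoc cis_mult left_diff_distrib)
  also have "\<dots> = (\<Sum>n\<in>F. c n * mean (\<lambda>x. cis (of_int (n - m) * x)))"
    using assms by (simp add: mean_sum mean_mult_right continuous_intros)
  also have "\<dots> = (\<Sum>n\<in>F. if n = m then c n else 0)"
    unfolding mean_cis by (intro sum.cong) auto
  also have "\<dots> = (if m \<in> F then c m else 0)"
    using assms by (simp add: sum.delta)
  finally show ?thesis .
qed

text \<open>
  Orthogonality makes each subtracted term \<open>c e\<^bsup>inx\<^esup>\<close> lower the mean square by exactly \<open>\<bar>c\<bar>\<^sup>2\<close>, so the
  terms can be removed one at a time. The exact value of the error, rather than an upper bound, is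
  what turns the known value of \<open>\<Sum> 1 / n\<^sup>2\<close> into mean square convergence of a Fourier series.
\<close>
lemma bessel_identity:
  assumes f: "continuous_on period f" and G: "finite G"
  shows "mean (\<lambda>x. (cmod (f x - (\<Sum>n\<in>G. fourier_coeff f n * cis (of_int n * x))))\<^sup>2)
    = mean (\<lambda>x. (cmod (f x))\<^sup>2) - (\<Sum>n\<in>G. (cmod (fourier_coeff f n))\<^sup>2)"
  using G
proof (induction G)
  case (insert n G)
  define g where "g = (\<lambda>x. f x - (\<Sum>k\<in>G. fourier_coeff f k * cis (of_int k * x)))"
  define c where "c = fourier_coeff f n"
  have g: "continuous_on period g"
    unfolding g_def by (intro continuous_intros f)
  have gc: "fourier_coeff g n = c"
  proof -
    have "fourier_coeff g n = mean (\<lambda>x. f x * cis (- (of_int n * x))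
      - (\<Sum>k\<in>G. fourier_coeff f k * cis (of_int k * x)) * cis (- (of_int n * x)))"
      unfolding fourier_coeff_def[of g] by (simp add: g_def left_diff_distrib)
    also have "\<dots> = c - fourier_coeff (\<lambda>x. \<Sum>k\<in>G. fourier_coeff f k * cis (of_int k * x)) n"
      unfolding c_def fourier_coeff_def[of f n]
        fourier_coeff_def[of "\<lambda>x. \<Sum>k\<in>G. fourier_coeff f k * cis (of_int k * x)" n]
      by (rule mean_diff) (intro continuous_intros f)+
    also have "\<dots> = c" using insert by (simp add: fourier_coeff_trig_poly)
    finally show ?thesis .
  qed
  \<comment> \<open>Expansion of the square, using that \<open>cis\<close> has modulus one.\<close>
  have pt: "(cmod (g x - c * cis (of_int n * x)))\<^sup>2 = ((cmod (g x))\<^sup>2 + (cmod c)\<^sup>2)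
      - 2 * Re (cnj c * (g x * cis (- (of_int n * x))))" for x
    unfolding cmod_power2
    by (simp, insert sin_cos_squared_add[of "of_int n * x"], algebra)
  have bl: "bounded_linear (\<lambda>z. 2 * Re (cnj c * z))"
    by (rule bounded_linear_compose[OF bounded_linear_mult_right
          bounded_linear_compose[OF bounded_linear_Re bounded_linear_mult_right]])
  have "mean (\<lambda>x. (cmod (f x - (\<Sum>k\<in>insert n G. fourier_coeff f k * cis (of_int k * x))))\<^sup>2)
    = mean (\<lambda>x. (cmod (g x - c * cis (of_int n * x)))\<^sup>2)"
    using insert by (simp add: g_def c_def algebra_simps)
  also have "\<dots> = mean (\<lambda>x. (cmod (g x))\<^sup>2 + (cmod c)\<^sup>2)
      - mean (\<lambda>x. 2 * Re (cnj c * (g x * cis (- (of_int n * x)))))"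
    unfolding pt by (rule mean_diff) (intro continuous_intros g)+
  also have "mean (\<lambda>x. (cmod (g x))\<^sup>2 + (cmod c)\<^sup>2) = mean (\<lambda>x. (cmod (g x))\<^sup>2) + (cmod c)\<^sup>2"
    using mean_const[of "(cmod c)\<^sup>2"] by (subst mean_add) (auto intro!: continuous_intros g)
  also have "mean (\<lambda>x. 2 * Re (cnj c * (g x * cis (- (of_int n * x)))))
      = 2 * Re (cnj c * fourier_coeff g n)"
    unfolding fourier_coeff_def by (rule mean_linear[OF _ bl]) (intro continuous_intros g)
  also have "mean (\<lambda>x. (cmod (g x))\<^sup>2) + (cmod c)\<^sup>2 - 2 * Re (cnj c * fourier_coeff g n)
      = mean (\<lambda>x. (cmod (g x))\<^sup>2) - (cmod c)\<^sup>2"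
    unfolding gc cmod_power2[of c] by (simp add: power2_eq_square)
  finally show ?case using insert by (simp add: g_def c_def)
qed simp

lemma bessel_inequality:
  assumes f: "continuous_on period f" and G: "finite G"
  shows "(\<Sum>n\<in>G. (cmod (fourier_coeff f n))\<^sup>2) \<le> mean (\<lambda>x. (cmod (f x))\<^sup>2)"
proof -
  have "mean (\<lambda>x. 0::real)
      \<le> mean (\<lambda>x. (cmod (f x - (\<Sum>n\<in>G. fourier_coeff f n * cis (of_int n * x))))\<^sup>2)"
    by (rule mean_mono) (auto intro!: continuous_intros f)
  then show ?thesis
    unfolding bessel_identity[OF assms] by (simp add: mean_const)
qed

lemma parseval_trig_poly:
  assumes "finite F"
  shows "mean (\<lambda>x. (cmod (\<Sum>n\<in>F. c n * cis (of_int n * x)))\<^sup>2) = (\<Sum>n\<in>F. (cmod (c n))\<^sup>2)"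
proof -
  let ?f = "\<lambda>x. \<Sum>n\<in>F. c n * cis (of_int n * x)"
  have "mean (\<lambda>x. (cmod (?f x - (\<Sum>n\<in>F. fourier_coeff ?f n * cis (of_int n * x))))\<^sup>2)
      = mean (\<lambda>x. (cmod (?f x))\<^sup>2) - (\<Sum>n\<in>F. (cmod (fourier_coeff ?f n))\<^sup>2)"
    by (rule bessel_identity) (auto intro!: continuous_intros assms)
  then show ?thesis
    by (simp add: fourier_coeff_trig_poly assms mean_const cong: sum.cong)
qed

section \<open>The symbol of the Hilbert transform\<close>

text \<open>
  With \<open>a\<close> pictured as \<open>\<Sum>n. a\<^sub>n e\<^bsup>-inx\<^esup>\<close>, the operator \<^const>\<open>H\<close> becomes multiplication by this
  function: the entry \<open>1 / j\<close> of \<^const>\<open>H\<close> is its mean against \<open>e\<^bsup>ijx\<^esup>\<close>. For \<open>j = 0\<close> this mean is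
  \<open>0 = 1 / 0\<close>, so that the omitted diagonal of \<^const>\<open>H\<close> needs no separate treatment.
\<close>
definition sawtooth :: "real \<Rightarrow> complex" where
  "sawtooth x = \<i> * of_real (x - pi)"

lemma continuous_sawtooth [continuous_intros]: "continuous_on S sawtooth"
  unfolding sawtooth_def by (intro continuous_intros)

lemma cmod_sawtooth_le: "x \<in> period \<Longrightarrow> cmod (sawtooth x) \<le> pi"
  by (auto simp: sawtooth_def norm_mult abs_le_iff simp flip: of_real_diff)

lemma mean_sawtooth_cis: "mean (\<lambda>x. sawtooth x * cis (of_int j * x)) = 1 / of_int j"
proof (cases "j = 0")
  case True
  have "(sawtooth has_integral
      \<i> * (of_real (2 * pi) ^ 2 / 2 - of_real pi * of_real (2 * pi))
      - \<i> * (of_real 0 ^ 2 / 2 - of_real pi * of_real 0)) period"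
    by (rule fundamental_theorem_of_calculus, simp,
        rule has_vector_derivative_real_field[where f = "\<lambda>z. \<i> * (z ^ 2 / 2 - of_real pi * z)"])
      (auto intro!: derivative_eq_intros simp: sawtooth_def)
  then show ?thesis using True by (simp add: mean_def integral_unique power2_eq_square)
next
  case False
  \<comment> \<open>An antiderivative, found by integrating by parts once.\<close>
  define F where "F z = (z - of_real pi) * exp (\<i> * (of_int j * z)) / of_int j
      + \<i> * exp (\<i> * (of_int j * z)) / of_int j ^ 2" for z :: complex
  have "((\<lambda>x. sawtooth x * cis (of_int j * x)) has_integral
      F (of_real (2 * pi)) - F (of_real 0)) period"
    by (rule fundamental_theorem_of_calculus, simp, rule has_vector_derivative_real_field[where f = F],
        unfold F_def)
      (use False in \<open>auto intro!: derivative_eq_intros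
        simp: sawtooth_def cis_conv_exp field_simps power2_eq_square\<close>)
  moreover have "cis (of_int j * (2 * pi)) = 1"
    using cis_multiple_2pi[of "of_int j"] by (simp add: mult.commute)
  ultimately show ?thesis using False by (simp add: mean_def integral_unique F_def cis_conv_exp scaleR_conv_of_real field_simps)
qed

lemma mean_cmod_sawtooth_power2: "mean (\<lambda>x. (cmod (sawtooth x))\<^sup>2) = pi\<^sup>2 / 3"
proof -
  have eq: "(cmod (sawtooth x))\<^sup>2 = (x - pi)\<^sup>2" for x
    by (simp add: sawtooth_def norm_mult flip: of_real_diff)
  have "((\<lambda>x. (x - pi)\<^sup>2) has_integral ((2 * pi - pi) ^ 3 / 3) - ((0 - pi) ^ 3 / 3)) period"
    by (rule fundamental_theorem_of_calculus)
      (auto intro!: derivative_eq_intros simp: has_real_derivative_iff_has_vector_derivative[symmetric] power2_eq_square)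
  then show ?thesis unfolding eq by (simp add: mean_def integral_unique field_simps power2_eq_square power3_eq_cube)
qed

lemma inverse_square_int_has_sum: "((\<lambda>n::int. 1 / (real_of_int n)\<^sup>2) has_sum pi\<^sup>2 / 3) UNIV"
proof -
  have "((\<lambda>n::nat. 1 / (real n + 1)\<^sup>2) has_sum pi\<^sup>2 / 6) UNIV"
    using inverse_squares_sums by (intro norm_summable_imp_has_sum) (auto simp: sums_iff add.commute)
  then have p: "((\<lambda>n::int. 1 / (real_of_int n)\<^sup>2) has_sum pi\<^sup>2 / 6) {0<..}"
    by (subst has_sum_reindex_bij_witness[where j = "\<lambda>n. nat (n - 1)" and i = "\<lambda>n. int n + 1" and T = UNIV
       and h = "\<lambda>n::nat. 1 / (real n + 1)\<^sup>2"]) auto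
  then have m: "((\<lambda>n::int. 1 / (real_of_int n)\<^sup>2) has_sum pi\<^sup>2 / 6) {..<0}"
    by (subst has_sum_reindex_bij_witness[where j = uminus and i = uminus and T = "{0<..}"
       and h = "\<lambda>n::int. 1 / (real_of_int n)\<^sup>2"]) auto
  have "((\<lambda>n::int. 1 / (real_of_int n)\<^sup>2) has_sum (pi\<^sup>2 / 6 + pi\<^sup>2 / 6)) ({0<..} \<union> {..<0})"
    by (rule has_sum_Un_disjoint[OF p m]) auto
  then show ?thesis
    by (subst has_sum_cong_neutral[where T = "{0<..} \<union> {..<0}"]) auto
qed

section \<open>Boundedness of the Hilbert transform\<close>

lemma fourier_coeff_sawtooth_trig_poly:
  assumes "finite F"
  shows "fourier_coeff (\<lambda>x. sawtooth x * (\<Sum>n\<in>F. a n * cis (of_int n * x))) m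
    = - (\<Sum>n\<in>F. a n / of_int (m - n))"
proof -
  have "fourier_coeff (\<lambda>x. sawtooth x * (\<Sum>n\<in>F. a n * cis (of_int n * x))) m
      = mean (\<lambda>x. \<Sum>n\<in>F. a n * (sawtooth x * cis (of_int (n - m) * x)))"
    by (simp add: fourier_coeff_def sum_distrib_right sum_distrib_left mult.assoc cis_mult
        left_diff_distrib mult.left_commute)
  also have "\<dots> = (\<Sum>n\<in>F. a n / of_int (n - m))"
    using assms
    by (simp add: mean_sum mean_mult_right continuous_intros mean_sawtooth_cis del: of_int_diff)
  also have "\<dots> = - (\<Sum>n\<in>F. a n / of_int (m - n))"
    unfolding sum_negf[symmetric]
    by (intro sum.cong refl) (metis minus_diff_eq minus_divide_right of_int_minus)
  finally show ?thesis .
qed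

text \<open>
  Up to sign, the left-hand side consists of Fourier coefficients of a trigonometric polynomial times the
  sawtooth function. Bessel's inequality bounds them by the mean square of that product, the
  sawtooth function is at most \<open>\<pi>\<close> in modulus, and Parseval's identity for the polynomial does the
  rest.
\<close>
lemma hilbert_inequality:
  assumes "finite F" "finite G"
  shows "L2_set (\<lambda>m. cmod (\<Sum>n\<in>F. a n / of_int (m - n))) G
    \<le> pi * L2_set (\<lambda>n. cmod (a n)) F"
proof -
  define p where "p x = (\<Sum>n\<in>F. a n * cis (of_int n * x))" for x
  have p: "continuous_on period p"
    unfolding p_def by (intro continuous_intros)
  have "(\<Sum>m\<in>G. (cmod (\<Sum>n\<in>F. a n / of_int (m - n)))\<^sup>2)
      = (\<Sum>m\<in>G. (cmod (fourier_coeff (\<lambda>x. sawtooth x * p x) m))\<^sup>2)"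
    unfolding p_def fourier_coeff_sawtooth_trig_poly[OF assms(1)] by simp
  also have "\<dots> \<le> mean (\<lambda>x. (cmod (sawtooth x * p x))\<^sup>2)"
    by (intro bessel_inequality continuous_intros p assms)
  also have "\<dots> \<le> mean (\<lambda>x. pi\<^sup>2 * (cmod (p x))\<^sup>2)"
    by (intro mean_mono continuous_intros p)
      (auto simp: norm_mult power_mult_distrib intro!: mult_right_mono power_mono cmod_sawtooth_le)
  also have "\<dots> = pi\<^sup>2 * (\<Sum>n\<in>F. (cmod (a n))\<^sup>2)"
    using parseval_trig_poly[OF assms(1), of a] p
    by (subst mean_mult_right) (auto intro!: continuous_intros simp: p_def)
  finally have "sqrt (\<Sum>m\<in>G. (cmod (\<Sum>n\<in>F. a n / of_int (m - n)))\<^sup>2)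
      \<le> sqrt (pi\<^sup>2 * (\<Sum>n\<in>F. (cmod (a n))\<^sup>2))"
    by (rule real_sqrt_le_mono)
  then show ?thesis
    unfolding L2_set_def real_sqrt_mult by (simp del: of_int_diff)
qed

lemma inverse_square_shift_has_sum:
  "((\<lambda>n::int. 1 / (real_of_int (m - n))\<^sup>2) has_sum pi\<^sup>2 / 3) UNIV"
  using inverse_square_int_has_sum
  by (subst has_sum_reindex_bij_witness[where j = "\<lambda>n. m - n" and i = "\<lambda>n. m - n" and T = UNIV
      and h = "\<lambda>n::int. 1 / (real_of_int n)\<^sup>2"]) auto

lemma cmod_square_summable: "(\<lambda>n. (cmod (coord a n))\<^sup>2) summable_on UNIV"
  using coord[of a] by simp

lemma summable_on_mult_square_summable:
  fixes f g :: "'b \<Rightarrow> real"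
  assumes "(\<lambda>n. (f n)\<^sup>2) summable_on A" "(\<lambda>n. (g n)\<^sup>2) summable_on A"
  shows "(\<lambda>n. \<bar>f n * g n\<bar>) summable_on A"
proof (rule summable_on_comparison_test)
  show "(\<lambda>n. (f n)\<^sup>2 + (g n)\<^sup>2) summable_on A"
    by (intro summable_on_add assms)
  show "\<bar>f n * g n\<bar> \<le> (f n)\<^sup>2 + (g n)\<^sup>2" for n
  proof -
    have "2 * \<bar>f n\<bar> * \<bar>g n\<bar> \<le> (f n)\<^sup>2 + (g n)\<^sup>2"
      using sum_squares_bound[of "\<bar>f n\<bar>" "\<bar>g n\<bar>"] by simp
    moreover have "0 \<le> \<bar>f n\<bar> * \<bar>g n\<bar>" by simp
    ultimately show ?thesis unfolding abs_mult by linarith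
  qed
qed auto

lemma hilbert_kernel_summable:
  "(\<lambda>n. coord a n / of_int (m - n)) summable_on UNIV"
proof (rule abs_summable_summable, rule summable_on_comparison_test)
  show "(\<lambda>n. \<bar>cmod (coord a n) * (1 / of_int (m - n))\<bar>) summable_on UNIV"
    by (rule summable_on_mult_square_summable)
      (use cmod_square_summable inverse_square_shift_has_sum[of m] in
        \<open>auto simp: power_divide has_sum_imp_summable\<close>)
qed (auto simp: norm_divide abs_mult simp flip: of_int_diff)

lemma L2_set_hilbert_transform_le:
  assumes "finite G"
  shows "L2_set (\<lambda>m. cmod (\<Sum>\<^sub>\<infinity>n. coord a n / of_int (m - n))) G \<le> pi * norm a"
proof (rule tendsto_upperbound)
  show "((\<lambda>F. L2_set (\<lambda>m. cmod (\<Sum>n\<in>F. coord a n / of_int (m - n))) G) \<longlongrightarrow>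
      L2_set (\<lambda>m. cmod (\<Sum>\<^sub>\<infinity>n. coord a n / of_int (m - n))) G) (finite_subsets_at_top UNIV)"
    unfolding L2_set_def by (intro tendsto_intros infsum_tendsto hilbert_kernel_summable)
  show "\<forall>\<^sub>F F in finite_subsets_at_top UNIV.
      L2_set (\<lambda>m. cmod (\<Sum>n\<in>F. coord a n / of_int (m - n))) G \<le> pi * norm a"
  proof (rule eventually_finite_subsets_at_top_weakI)
    fix F :: "int set" assume F: "finite F"
    have "L2_set (\<lambda>m. cmod (\<Sum>n\<in>F. coord a n / of_int (m - n))) G
        \<le> pi * L2_set (\<lambda>n. cmod (coord a n)) F"
      by (rule hilbert_inequality[OF F assms])
    also have "\<dots> \<le> pi * norm a"
      by (intro mult_left_mono L2_set_le_norm_l2 F) simp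
    finally show "L2_set (\<lambda>m. cmod (\<Sum>n\<in>F. coord a n / of_int (m - n))) G \<le> pi * norm a" .
  qed
qed simp

text \<open>
  Here \<open>1 / 0 = 0\<close> lets the sum run over all integers. The content is that \<^const>\<open>Abs_l2\<close> and
  \<^const>\<open>Blinfun\<close> in the definition of \<^const>\<open>H\<close> are applied inside their domains.
\<close>
lemma coord_H: "coord (blinfun_apply H a) m = (\<Sum>\<^sub>\<infinity>n. coord a n / of_int (m - n))"
proof -
  define T where "T a = Abs_l2 (\<lambda>m. \<Sum>\<^sub>\<infinity>n. coord a n / of_int (m - n))" for a
  have T: "coord (T a) m = (\<Sum>\<^sub>\<infinity>n. coord a n / of_int (m - n))" for a m
    unfolding T_def
    by (subst Abs_l2_inverse) (rule CollectI square_summable_bound(1)[OF L2_set_hilbert_transform_le] refl, assumption?)+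
  have bl: "bounded_linear T"
  proof (rule bounded_linear_intro)
    fix a b :: l2 and r :: real
    show "T (a + b) = T a + T b"
      by (simp add: coord_inject[symmetric] fun_eq_iff T plus_l2.rep_eq add_divide_distrib
          infsum_add hilbert_kernel_summable del: of_int_diff)
    show "T (r *\<^sub>R a) = r *\<^sub>R T a"
    proof -
      have "(\<Sum>\<^sub>\<infinity>n. (r *\<^sub>R coord a n) / of_int (m - n)) = r *\<^sub>R (\<Sum>\<^sub>\<infinity>n. coord a n / of_int (m - n))" for m
        using infsum_cmult_right'[of "of_real r :: complex" "\<lambda>n. coord a n / of_int (m - n)" UNIV]
        by (simp only: scaleR_conv_of_real times_divide_eq_right)
      then show ?thesis
        by (simp add: coord_inject[symmetric] fun_eq_iff T scaleR_l2.rep_eq del: of_int_diff)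
    qed
    show "norm (T a) \<le> norm a * pi"
      by (subst mult.commute, rule norm_l2_le) (simp add: T L2_set_hilbert_transform_le del: of_int_diff)
  qed
  have "H = Blinfun T"
    unfolding H_def T_def
    by (intro arg_cong[where f = Blinfun] arg_cong[where f = Abs_l2] ext infsum_cong_neutral) auto
  then have "blinfun_apply H = T"
    using bounded_linear_Blinfun_apply[OF bl] by (rule ssubst)
  then show ?thesis
    using T[of a m] by metis
qed

lemma coord_H_has_sum:
  "((\<lambda>n. coord a n / of_int (m - n)) has_sum coord (blinfun_apply H a) m) UNIV"
  unfolding coord_H by (rule has_sum_infsum[OF hilbert_kernel_summable])

section \<open>The orbit of \<open>\<delta>\<^sub>0\<close> under \<open>H\<close> and \<open>e\<^sup>t\<^sup>H\<close>\<close>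

lemma cmod_mean_power2_le:
  assumes "continuous_on period f"
  shows "(cmod (mean f))\<^sup>2 \<le> mean (\<lambda>x. (cmod (f x))\<^sup>2)"
  using bessel_inequality[OF assms, of "{0}"] by (simp add: fourier_coeff_def)

text \<open>
  This is Parseval's identity for the sawtooth function and \<open>\<phi>\<close>: applying \<^const>\<open>H\<close> to the sequence
  of means of \<open>\<phi> e\<^bsup>inx\<^esup>\<close> corresponds to multiplying \<open>\<phi>\<close> by the sawtooth function. The mean square
  distance of the sawtooth function times \<open>e\<^bsup>imx\<^esup>\<close> to a partial sum of its Fourier series is
  \<open>\<pi>\<^sup>2 / 3 - \<Sum> 1 / (m - n)\<^sup>2\<close>, which tends to \<open>0\<close>.
\<close>
lemma mean_sawtooth_mult_has_sum:
  assumes \<phi>: "continuous_on period \<phi>"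
  shows "((\<lambda>n. mean (\<lambda>x. \<phi> x * cis (of_int n * x)) / of_int (m - n)) has_sum
    mean (\<lambda>x. sawtooth x * \<phi> x * cis (of_int m * x))) UNIV"
proof -
  define g where "g x = sawtooth x * cis (of_int m * x)" for x
  \<comment> \<open>The remainder of the Fourier series of \<open>g\<close>.\<close>
  define r where "r F x = g x - (\<Sum>n\<in>F. fourier_coeff g n * cis (of_int n * x))" for F x
  have g: "continuous_on period g"
    unfolding g_def by (intro continuous_intros)
  have r: "continuous_on period (r F)" for F
    unfolding r_def by (intro continuous_intros g)
  have gc: "fourier_coeff g n = 1 / of_int (m - n)" for n
  proof -
    have "fourier_coeff g n = mean (\<lambda>x. sawtooth x * cis (of_int (m - n) * x))"
      by (simp add: fourier_coeff_def g_def mult.assoc cis_mult left_diff_distrib)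
    then show ?thesis by (simp only: mean_sawtooth_cis)
  qed
  have "compact (\<phi> ` period)" using \<phi> by (intro compact_continuous_image) auto
  then obtain M where M: "\<And>x. x \<in> period \<Longrightarrow> cmod (\<phi> x) \<le> M"
    by (meson bounded_iff compact_imp_bounded imageI)
  have M0: "0 \<le> M" using M[of 0] norm_ge_zero[of "\<phi> 0"] by (simp del: norm_ge_zero)
  have eq: "mean (\<lambda>x. \<phi> x * r F x) = mean (\<lambda>x. sawtooth x * \<phi> x * cis (of_int m * x))
      - (\<Sum>n\<in>F. mean (\<lambda>x. \<phi> x * cis (of_int n * x)) / of_int (m - n))" if F: "finite F" for F
  proof -
    have "mean (\<lambda>x. \<phi> x * r F x) = mean (\<lambda>x. sawtooth x * \<phi> x * cis (of_int m * x)
        - (\<Sum>n\<in>F. fourier_coeff g n * (\<phi> x * cis (of_int n * x))))"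
      by (simp add: r_def g_def right_diff_distrib sum_distrib_left ac_simps)
    also have "\<dots> = mean (\<lambda>x. sawtooth x * \<phi> x * cis (of_int m * x))
        - (\<Sum>n\<in>F. fourier_coeff g n * mean (\<lambda>x. \<phi> x * cis (of_int n * x)))"
      using F \<phi> by (simp add: mean_diff mean_sum mean_mult_right continuous_intros)
    finally show ?thesis by (simp add: gc)
  qed
  have bound: "cmod ((\<Sum>n\<in>F. mean (\<lambda>x. \<phi> x * cis (of_int n * x)) / of_int (m - n))
        - mean (\<lambda>x. sawtooth x * \<phi> x * cis (of_int m * x)))
      \<le> M * sqrt (pi\<^sup>2 / 3 - (\<Sum>n\<in>F. 1 / (real_of_int (m - n))\<^sup>2))" if F: "finite F" for F
  proof -
    have "(cmod (mean (\<lambda>x. \<phi> x * r F x)))\<^sup>2 \<le> mean (\<lambda>x. (cmod (\<phi> x * r F x))\<^sup>2)"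
      by (intro cmod_mean_power2_le continuous_intros \<phi> r)
    also have "\<dots> \<le> mean (\<lambda>x. M\<^sup>2 * (cmod (r F x))\<^sup>2)"
      by (intro mean_mono continuous_intros \<phi> r)
        (auto simp: norm_mult power_mult_distrib intro!: mult_right_mono power_mono M)
    also have "\<dots> = M\<^sup>2 * mean (\<lambda>x. (cmod (r F x))\<^sup>2)"
      by (intro mean_mult_right continuous_intros r)
    also have "mean (\<lambda>x. (cmod (r F x))\<^sup>2)
        = mean (\<lambda>x. (cmod (g x))\<^sup>2) - (\<Sum>n\<in>F. (cmod (fourier_coeff g n))\<^sup>2)"
      unfolding r_def by (rule bessel_identity[OF g F])
    also have "mean (\<lambda>x. (cmod (g x))\<^sup>2) = pi\<^sup>2 / 3"
      using mean_cmod_sawtooth_power2 by (simp add: g_def norm_mult)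
    also have "(\<Sum>n\<in>F. (cmod (fourier_coeff g n))\<^sup>2) = (\<Sum>n\<in>F. 1 / (real_of_int (m - n))\<^sup>2)"
      by (simp add: gc norm_divide power_divide flip: of_int_diff)
    finally have "cmod (mean (\<lambda>x. \<phi> x * r F x))
        \<le> sqrt (M\<^sup>2 * (pi\<^sup>2 / 3 - (\<Sum>n\<in>F. 1 / (real_of_int (m - n))\<^sup>2)))"
      by (rule real_le_rsqrt)
    then show ?thesis
      unfolding eq[OF F] using M0 by (simp add: real_sqrt_mult norm_minus_commute)
  qed
  have lim: "((\<lambda>F. M * sqrt (pi\<^sup>2 / 3 - (\<Sum>n\<in>F. 1 / (real_of_int (m - n))\<^sup>2))) \<longlongrightarrow>
      M * sqrt (pi\<^sup>2 / 3 - pi\<^sup>2 / 3)) (finite_subsets_at_top UNIV)"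
    by (intro tendsto_intros inverse_square_shift_has_sum[unfolded has_sum_def])
  show ?thesis
    unfolding has_sum_def
    by (rule LIM_zero_cancel, rule Lim_null_comparison[OF _ lim[simplified]])
      (use bound in \<open>auto intro!: eventually_finite_subsets_at_top_weakI\<close>)
qed

lift_definition delta0 :: l2 is "\<lambda>n. if n = 0 then 1 else 0"
proof -
  have "(\<lambda>n::int. (cmod (if n = 0 then 1 else 0))\<^sup>2) summable_on {0}" by simp
  then show "(\<lambda>n::int. (cmod (if n = 0 then 1 else 0))\<^sup>2) summable_on UNIV"
    by (subst summable_on_cong_neutral[where T = "{0}"]) auto
qed

lemma coord_H_power_delta0:
  "coord (blinfun_apply (blinfun_power H k) delta0) m
    = mean (\<lambda>x. sawtooth x ^ k * cis (of_int m * x))"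
proof (induction k arbitrary: m)
  case 0
  then show ?case by (simp add: delta0.rep_eq mean_cis)
next
  case (Suc k)
  have "((\<lambda>n. mean (\<lambda>x. sawtooth x ^ k * cis (of_int n * x)) / of_int (m - n)) has_sum
      coord (blinfun_apply (blinfun_power H (Suc k)) delta0) m) UNIV"
    using coord_H_has_sum[of "blinfun_apply (blinfun_power H k) delta0" m] by (simp add: Suc)
  moreover have "((\<lambda>n. mean (\<lambda>x. sawtooth x ^ k * cis (of_int n * x)) / of_int (m - n)) has_sum
      mean (\<lambda>x. sawtooth x * sawtooth x ^ k * cis (of_int m * x))) UNIV"
    by (intro mean_sawtooth_mult_has_sum continuous_intros)
  ultimately show ?case
    by (simp add: has_sum_unique)
qed

text \<open>
  Termwise integration of the exponential series, which converges uniformly on the period.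
\<close>
lemma mean_exp_sawtooth_sums:
  "(\<lambda>k. (t ^ k / fact k) *\<^sub>R mean (\<lambda>x. sawtooth x ^ k * cis (of_int m * x))) sums
    mean (\<lambda>x. exp (of_real t * sawtooth x) * cis (of_int m * x))"
proof -
  define f where "f k x = (t ^ k / fact k) *\<^sub>R (sawtooth x ^ k * cis (of_int m * x))" for k x
  define g where "g x = exp (of_real t * sawtooth x) * cis (of_int m * x)" for x
  have c: "continuous_on period (f k)" for k
    unfolding f_def by (intro continuous_intros)
  have fg: "(\<lambda>k. f k x) sums g x" for x
  proof -
    have "(\<lambda>k. ((of_real t * sawtooth x) ^ k /\<^sub>R fact k) * cis (of_int m * x)) sums g x"
      unfolding g_def by (intro sums_mult2 exp_converges)
    then show ?thesis
      by (simp add: f_def scaleR_conv_of_real power_mult_distrib field_simps)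
  qed
  have "uniform_limit period (\<lambda>N x. \<Sum>k<N. f k x) (\<lambda>x. \<Sum>k. f k x) sequentially"
  proof (rule Weierstrass_m_test)
    show "norm (f k x) \<le> (\<bar>t\<bar> * pi) ^ k /\<^sub>R fact k" if "x \<in> period" for k x
      using mult_left_mono[OF power_mono[OF cmod_sawtooth_le[OF that], of k], of "\<bar>t\<bar> ^ k"]
      by (simp add: f_def norm_mult norm_power power_abs power_mult_distrib field_simps)
    show "summable (\<lambda>k. (\<bar>t\<bar> * pi) ^ k /\<^sub>R fact k)"
      by (rule summable_exp_generic)
  qed
  then obtain I J where I: "\<And>N. ((\<lambda>x. \<Sum>k<N. f k x) has_integral I N) period"
      and J: "((\<lambda>x. \<Sum>k. f k x) has_integral J) period" and IJ: "I \<longlonglongrightarrow> J"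
    by (rule uniform_limit_integral) (auto intro!: continuous_intros c)
  have "I N /\<^sub>R (2 * pi) = (\<Sum>k<N. mean (f k))" for N
    using mean_sum[of "{..<N}" f] c I[of N] by (simp add: mean_eqI)
  moreover have "J /\<^sub>R (2 * pi) = mean g"
    using J fg by (simp add: sums_iff mean_eqI)
  moreover have "mean (f k) = (t ^ k / fact k) *\<^sub>R mean (\<lambda>x. sawtooth x ^ k * cis (of_int m * x))" for k
    unfolding f_def by (rule mean_linear[OF _ bounded_linear_scaleR_right]) (intro continuous_intros)
  ultimately show ?thesis
    using tendsto_scaleR[OF tendsto_const IJ, of "inverse (2 * pi)"]
    unfolding sums_def g_def by simp
qed

lemma mean_cis_sinc: "mean (\<lambda>x. cis (s * (x - pi))) = of_real (sinc s)"
proof (cases "s = 0")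
  case False
  define F where "F z = exp (\<i> * (of_real s * (z - of_real pi))) / (\<i> * of_real s)" for z
  have "((\<lambda>x. cis (s * (x - pi))) has_integral F (of_real (2 * pi)) - F (of_real 0)) period"
    by (rule fundamental_theorem_of_calculus, simp, rule has_vector_derivative_real_field[where f = F],
        unfold F_def)
      (use False in \<open>auto intro!: derivative_eq_intros simp: cis_conv_exp field_simps\<close>)
  moreover have "F (of_real (2 * pi)) - F (of_real 0) = (cis (s * pi) - cis (- (s * pi))) / (\<i> * of_real s)"
    by (simp add: F_def cis_conv_exp diff_divide_distrib)
  also have "cis (s * pi) - cis (- (s * pi)) = 2 * \<i> * of_real (sin (pi * s))"
    by (simp add: complex_eq_iff mult.commute)
  also have "2 * \<i> * of_real (sin (pi * s)) / (\<i> * of_real s) = of_real (2 * sin (pi * s) / s)"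
    using False by (simp add: field_simps)
  finally show ?thesis
    using False by (simp add: mean_def integral_unique sinc_def scaleR_conv_of_real field_simps)
qed (simp add: mean_const sinc_def)

text \<open>
  The exponent \<open>t (x - \<pi>) + m x\<close> equals \<open>(t + m) (x - \<pi>) + m \<pi>\<close>; the last summand is the source of
  the sign \<open>(-1)\<^sup>m\<close>.
\<close>
lemma mean_exp_sawtooth_cis:
  "mean (\<lambda>x. exp (of_real t * sawtooth x) * cis (of_int m * x)) = of_real ((-1) powi m * sinc (t + of_int m))"
proof -
  have "exp (of_real t * sawtooth x) * cis (of_int m * x)
      = (-1) powi m * cis ((t + of_int m) * (x - pi))" for x
  proof -
    have "exp (of_real t * sawtooth x) * cis (of_int m * x) = cis (t * (x - pi) + of_int m * x)"
      by (simp add: sawtooth_def cis_conv_exp exp_add[symmetric] algebra_simps)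
    also have "t * (x - pi) + of_int m * x = of_int m * pi + (t + of_int m) * (x - pi)"
      by (simp add: algebra_simps)
    also have "cis \<dots> = cis pi powi m * cis ((t + of_int m) * (x - pi))"
      by (simp only: cis_mult cis_power_int)
    finally show ?thesis by simp
  qed
  then show ?thesis
    by (simp add: mean_mult_right continuous_intros mean_cis_sinc)
qed

section \<open>The Banach algebra of bounded operators\<close>

text \<open>
  A copy of the bounded endomorphisms that carries composition as multiplication. It is an instance
  of \<^class>\<open>real_normed_algebra_1\<close> and \<^class>\<open>banach\<close>, so \<^const>\<open>exp\<close> with its addition law and its
  derivative applies to operators. A perfect space is nontrivial, which gives \<open>0 \<noteq> 1\<close> and
  \<open>\<parallel>1\<parallel> = 1\<close>.
\<close>
typedef (overloaded) 'a endo = "UNIV :: ('a::real_normed_vector \<Rightarrow>\<^sub>L 'a) set"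
  morphisms blinfun_of Endo ..

setup_lifting type_definition_endo

instantiation endo :: ("{banach,perfect_space}") real_normed_algebra_1
begin

lift_definition zero_endo :: "'a endo" is 0 .
lift_definition one_endo :: "'a endo" is id_blinfun .
lift_definition plus_endo :: "'a endo \<Rightarrow> 'a endo \<Rightarrow> 'a endo" is "(+)" .
lift_definition minus_endo :: "'a endo \<Rightarrow> 'a endo \<Rightarrow> 'a endo" is "(-)" .
lift_definition uminus_endo :: "'a endo \<Rightarrow> 'a endo" is uminus .
lift_definition times_endo :: "'a endo \<Rightarrow> 'a endo \<Rightarrow> 'a endo" is "(o\<^sub>L)" .
lift_definition scaleR_endo :: "real \<Rightarrow> 'a endo \<Rightarrow> 'a endo" is "(*\<^sub>R)" .
lift_definition norm_endo :: "'a endo \<Rightarrow> real" is norm .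

definition dist_endo :: "'a endo \<Rightarrow> 'a endo \<Rightarrow> real" where "dist_endo x y = norm (x - y)"
definition sgn_endo :: "'a endo \<Rightarrow> 'a endo" where "sgn_endo x = inverse (norm x) *\<^sub>R x"
definition uniformity_endo :: "('a endo \<times> 'a endo) filter"
  where "uniformity_endo = (INF e\<in>{0<..}. principal {(x, y). dist x y < e})"
definition open_endo :: "'a endo set \<Rightarrow> bool"
  where "open_endo S = (\<forall>x\<in>S. \<forall>\<^sub>F (x', y) in uniformity. x' = x \<longrightarrow> y \<in> S)"

instance
proof
  fix x y z :: "'a endo" and c d :: real
  show "x + y + z = x + (y + z)" by transfer (rule add.assoc)
  show "x + y = y + x" by transfer (rule add.commute)
  show "0 + x = x" by transfer simp
  show "- x + x = 0" by transfer simp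
  show "x - y = x + - y" by transfer simp
  show "c *\<^sub>R (x + y) = c *\<^sub>R x + c *\<^sub>R y" by transfer (rule scaleR_add_right)
  show "(c + d) *\<^sub>R x = c *\<^sub>R x + d *\<^sub>R x" by transfer (rule scaleR_add_left)
  show "c *\<^sub>R d *\<^sub>R x = (c * d) *\<^sub>R x" by transfer simp
  show "1 *\<^sub>R x = x" by transfer simp
  show "x * y * z = x * (y * z)" by transfer (auto intro: blinfun_eqI)
  show "1 * x = x" by transfer (auto intro: blinfun_eqI)
  show "x * 1 = x" by transfer (auto intro: blinfun_eqI)
  show "(x + y) * z = x * z + y * z"
    by transfer (rule bounded_bilinear.add_left[OF bounded_bilinear_blinfun_compose])
  show "x * (y + z) = x * y + x * z"
    by transfer (rule bounded_bilinear.add_right[OF bounded_bilinear_blinfun_compose])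
  show "c *\<^sub>R x * y = c *\<^sub>R (x * y)"
    by transfer (rule bounded_bilinear.scaleR_left[OF bounded_bilinear_blinfun_compose])
  show "x * c *\<^sub>R y = c *\<^sub>R (x * y)"
    by transfer (rule bounded_bilinear.scaleR_right[OF bounded_bilinear_blinfun_compose])
  show "(0 :: 'a endo) \<noteq> 1" by transfer (metis norm_blinfun_id norm_zero zero_neq_one)
  show "dist x y = norm (x - y)" by (simp add: dist_endo_def)
  show "sgn x = inverse (norm x) *\<^sub>R x" by (simp add: sgn_endo_def)
  show "(uniformity :: ('a endo \<times> 'a endo) filter) = (INF e\<in>{0<..}. principal {(x, y). dist x y < e})"
    by (simp add: uniformity_endo_def)
  show "open U = (\<forall>x\<in>U. \<forall>\<^sub>F (x', y) in uniformity. x' = x \<longrightarrow> y \<in> U)" for U :: "'a endo set"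
    by (simp add: open_endo_def)
  show "norm x = 0 \<longleftrightarrow> x = 0" by transfer simp
  show "norm (x + y) \<le> norm x + norm y" by transfer (rule norm_triangle_ineq)
  show "norm (c *\<^sub>R x) = \<bar>c\<bar> * norm x" by transfer simp
  show "norm (x * y) \<le> norm x * norm y" by transfer (rule norm_blinfun_compose)
  show "norm (1 :: 'a endo) = 1" by transfer simp
qed

end

instance endo :: ("{banach,perfect_space}") banach
proof
  fix X :: "nat \<Rightarrow> 'a endo"
  assume "Cauchy X"
  then have "Cauchy (\<lambda>n. blinfun_of (X n))"
    unfolding Cauchy_def dist_norm by (simp add: norm_endo.rep_eq minus_endo.rep_eq)
  then obtain L where "(\<lambda>n. blinfun_of (X n)) \<longlonglongrightarrow> L"
    using Cauchy_convergent convergent_def by blast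
  then have "X \<longlonglongrightarrow> Endo L"
    unfolding LIMSEQ_def dist_norm by (simp add: norm_endo.rep_eq minus_endo.rep_eq Endo_inverse)
  then show "convergent X" by (auto simp: convergent_def)
qed

definition act :: "'a::{banach,perfect_space} endo \<Rightarrow> 'a \<Rightarrow> 'a" where
  "act x v = blinfun_apply (blinfun_of x) v"

lemma bounded_linear_blinfun_of: "bounded_linear (blinfun_of :: 'a::{banach,perfect_space} endo \<Rightarrow> _)"
  by (rule bounded_linear_intro[where K = 1])
    (simp_all add: plus_endo.rep_eq scaleR_endo.rep_eq norm_endo.rep_eq)

lemma bounded_linear_act_left: "bounded_linear (\<lambda>x. act x v)"
  unfolding act_def
  by (rule bounded_linear_compose[OF blinfun.bounded_linear_left bounded_linear_blinfun_of])

lemma bounded_linear_act_right: "bounded_linear (act x)"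
  unfolding act_def by (rule blinfun.bounded_linear_right)

lemma act_mult: "act (x * y) v = act x (act y v)"
  by (simp add: act_def times_endo.rep_eq)

lemma act_one [simp]: "act 1 v = v"
  by (simp add: act_def one_endo.rep_eq)

lemma act_scaleR: "act (c *\<^sub>R x) v = c *\<^sub>R act x v"
  by (simp add: act_def scaleR_endo.rep_eq scaleR_blinfun.rep_eq)

lemma endo_eqI: "(\<And>v. act x v = act y v) \<Longrightarrow> x = y"
  by (simp add: act_def blinfun_of_inject[symmetric] blinfun_eqI)

section \<open>Weighted translations\<close>

lemma coord_add: "coord (a + b) n = coord a n + coord b n"
  and coord_scaleR: "coord (c *\<^sub>R a) n = c *\<^sub>R coord a n"
  and coord_diff: "coord (a - b) n = coord a n - coord b n"
  by (simp_all add: plus_l2.rep_eq scaleR_l2.rep_eq minus_l2.rep_eq)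

lemma l2_eqI: "(\<And>n. coord a n = coord b n) \<Longrightarrow> a = b"
  by (simp add: coord_inject[symmetric] fun_eq_iff)

lemma bounded_linear_coord: "bounded_linear (\<lambda>a. coord a n)"
  by (rule bounded_linear_intro[where K = 1])
    (simp_all add: coord_add coord_scaleR cmod_coord_le_norm)

lemma coord_delta0: "coord delta0 n = (if n = 0 then 1 else 0)"
  by (simp add: delta0.rep_eq)

instance l2 :: perfect_space
proof
  fix x :: l2
  show "\<not> open {x}"
  proof
    assume "open {x}"
    moreover have "((\<lambda>c. x + c *\<^sub>R delta0) \<longlongrightarrow> x + 0 *\<^sub>R delta0) (at (0::real))"
      by (intro tendsto_intros)
    ultimately have "\<forall>\<^sub>F c in at (0::real). x + c *\<^sub>R delta0 = x"
      by (auto dest: topological_tendstoD[where S = "{x}"])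
    moreover have "\<forall>\<^sub>F c in at (0::real). c \<noteq> 0"
      by (rule eventually_neq_at_within)
    ultimately have "\<forall>\<^sub>F c in at (0::real). False"
    proof eventually_elim
      case (elim c)
      then have "coord (c *\<^sub>R delta0) 0 = coord 0 0" by simp
      then show ?case using elim by (simp add: coord_scaleR coord_delta0 zero_l2.rep_eq)
    qed
    then show False by simp
  qed
qed

text \<open>
  Translations and complex scalars are combined into one family: since bounded operators are only
  recorded as real-linear, commuting with complex scalars has to be stated alongside commuting with
  translations.
\<close>
definition shift :: "int \<Rightarrow> complex \<Rightarrow> l2 endo" where
  "shift k c = Endo (Blinfun (\<lambda>a. Abs_l2 (\<lambda>n. c * coord a (n + k))))"

lemma coord_shift: "coord (act (shift k c) a) n = c * coord a (n + k)"
  and norm_shift_le: "norm (shift k c) \<le> cmod c"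
proof -
  define T where "T a = Abs_l2 (\<lambda>n. c * coord a (n + k))" for a
  have L2: "L2_set (\<lambda>n. cmod (c * coord a (n + k))) F \<le> cmod c * norm a" if "finite F" for a F
  proof -
    have "L2_set (\<lambda>n. cmod (c * coord a (n + k))) F = cmod c * L2_set (\<lambda>n. cmod (coord a (n + k))) F"
      by (simp add: norm_mult L2_set_right_distrib)
    also have "L2_set (\<lambda>n. cmod (coord a (n + k))) F = L2_set (\<lambda>n. cmod (coord a n)) ((\<lambda>n. n + k) ` F)"
      unfolding L2_set_def by (subst sum.reindex) (auto simp: inj_on_def)
    also have "cmod c * \<dots> \<le> cmod c * norm a"
      using that by (intro mult_left_mono L2_set_le_norm_l2) auto
    finally show ?thesis .
  qed
  have T: "coord (T a) n = c * coord a (n + k)" for a n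
    unfolding T_def by (subst Abs_l2_inverse) (use square_summable_bound(1)[OF L2] in auto)
  have n: "norm (T a) \<le> cmod c * norm a" for a
    by (rule norm_l2_le) (simp add: T L2)
  have "bounded_linear T"
    by (rule bounded_linear_intro[where K = "cmod c"])
      (auto intro!: l2_eqI simp: T coord_add coord_scaleR algebra_simps n[unfolded mult.commute[of "cmod c"]])
  then have act: "act (shift k c) a = T a" for a
    by (simp add: act_def shift_def T_def[symmetric] Endo_inverse bounded_linear_Blinfun_apply)
  show "coord (act (shift k c) a) n = c * coord a (n + k)"
    by (simp add: act T)
  show "norm (shift k c) \<le> cmod c"
    unfolding norm_endo.rep_eq
    by (rule norm_blinfun_bound) (use n act in \<open>auto simp: act_def\<close>)
qed

text \<open>
  The expansion of a sequence in the standard basis, whose elements are written as translates of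
  \<open>\<delta>\<^sub>0\<close>.
\<close>
lemma l2_has_sum_shift_delta0: "((\<lambda>k. act (shift (- k) (coord a k)) delta0) has_sum a) UNIV"
proof -
  define s where "s F = (\<Sum>k\<in>F. act (shift (- k) (coord a k)) delta0)" for F
  have cs: "coord (s F) n = (if n \<in> F then coord a n else 0)" if F: "finite F" for F n
  proof -
    have "coord (s F) n = (\<Sum>k\<in>F. coord (act (shift (- k) (coord a k)) delta0) n)"
      unfolding s_def using linear_sum[OF bounded_linear.linear[OF bounded_linear_coord]] .
    also have "\<dots> = (\<Sum>k\<in>F. if k = n then coord a k else 0)"
      by (intro sum.cong) (auto simp: coord_shift coord_delta0)
    finally show ?thesis using F by (simp add: sum.delta)
  qed
  have sq: "((\<lambda>n. (cmod (coord a n))\<^sup>2) has_sum (norm a)\<^sup>2) UNIV"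
    using has_sum_infsum[OF cmod_square_summable[of a]]
    by (simp add: norm_l2.rep_eq infsum_nonneg)
  have bound: "norm (s F - a) \<le> sqrt ((norm a)\<^sup>2 - (\<Sum>n\<in>F. (cmod (coord a n))\<^sup>2))" if F: "finite F" for F
  proof (rule norm_l2_le)
    fix G :: "int set" assume G: "finite G"
    have "(\<Sum>n\<in>G. (cmod (coord (s F - a) n))\<^sup>2) = (\<Sum>n\<in>G - F. (cmod (coord a n))\<^sup>2)"
      using G by (intro sum.mono_neutral_cong_right) (auto simp: coord_diff cs F)
    moreover have "(\<Sum>n\<in>G - F. (cmod (coord a n))\<^sup>2) + (\<Sum>n\<in>F. (cmod (coord a n))\<^sup>2)
        = (\<Sum>n\<in>(G - F) \<union> F. (cmod (coord a n))\<^sup>2)"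
      using F G by (subst sum.union_disjoint) auto
    moreover have "\<dots> \<le> (norm a)\<^sup>2"
      using finite_sum_le_has_sum[OF sq, of "(G - F) \<union> F"] F G by auto
    ultimately show "L2_set (\<lambda>n. cmod (coord (s F - a) n)) G
        \<le> sqrt ((norm a)\<^sup>2 - (\<Sum>n\<in>F. (cmod (coord a n))\<^sup>2))"
      unfolding L2_set_def by (intro real_sqrt_le_mono) linarith
  qed
  have lim: "((\<lambda>F. sqrt ((norm a)\<^sup>2 - (\<Sum>n\<in>F. (cmod (coord a n))\<^sup>2))) \<longlongrightarrow>
      sqrt ((norm a)\<^sup>2 - (norm a)\<^sup>2)) (finite_subsets_at_top UNIV)"
    by (intro tendsto_intros sq[unfolded has_sum_def])
  show ?thesis
    unfolding has_sum_def s_def[symmetric, abs_def]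
    by (rule LIM_zero_cancel, rule Lim_null_comparison[OF _ lim[simplified]])
      (use bound in \<open>auto intro!: eventually_finite_subsets_at_top_weakI simp: s_def\<close>)
qed

text \<open>
  Weighted translates of \<open>\<delta>\<^sub>0\<close> span a dense subspace, and the two operators agree on each of them.
\<close>
lemma shift_commutant_eqI:
  assumes x: "\<And>k c. x * shift k c = shift k c * x" and y: "\<And>k c. y * shift k c = shift k c * y"
    and eq: "act x delta0 = act y delta0"
  shows "x = y"
proof (rule endo_eqI)
  fix a
  have "((\<lambda>k. act x (act (shift (- k) (coord a k)) delta0)) has_sum act x a) UNIV"
    and "((\<lambda>k. act y (act (shift (- k) (coord a k)) delta0)) has_sum act y a) UNIV"
    by (intro has_sum_bounded_linear[OF bounded_linear_act_right] l2_has_sum_shift_delta0)+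
  moreover have "act x (act (shift k c) delta0) = act y (act (shift k c) delta0)" for k c
    by (simp add: x y eq flip: act_mult) (simp add: act_mult eq)
  ultimately show "act x a = act y a"
    by (simp add: has_sum_unique)
qed

section \<open>The group \<open>e\<^sup>t\<^sup>H\<close>\<close>

definition H_endo :: "l2 endo" where "H_endo = Endo H"

lemma act_H_endo_power: "act (H_endo ^ k) a = blinfun_apply (blinfun_power H k) a"
proof (induction k)
  case (Suc k)
  then show ?case by (simp add: act_mult) (simp add: act_def H_endo_def Endo_inverse)
qed simp

lemma blinfun_of_H_endo_power: "blinfun_of (H_endo ^ k) = blinfun_power H k"
  by (rule blinfun_eqI) (simp add: act_H_endo_power[unfolded act_def])

lemma exp_H_eq: "exp_H t = blinfun_of (exp (t *\<^sub>R H_endo))"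
proof -
  have "(\<lambda>k. blinfun_of ((t *\<^sub>R H_endo) ^ k /\<^sub>R fact k)) sums blinfun_of (exp (t *\<^sub>R H_endo))"
    by (rule bounded_linear.sums[OF bounded_linear_blinfun_of exp_converges])
  then show ?thesis
    unfolding exp_H_def
    by (simp add: sums_iff scaleR_endo.rep_eq blinfun_of_H_endo_power divide_inverse mult.commute)
qed

lemma H_endo_shift_commute: "H_endo * shift k c = shift k c * H_endo"
proof (rule endo_eqI, rule l2_eqI)
  fix a m
  have "((\<lambda>n. c * (coord a (n + k) / of_int (m - n))) has_sum coord (act H_endo (act (shift k c) a)) m) UNIV"
    using coord_H_has_sum[of "act (shift k c) a" m]
    by (simp add: act_def H_endo_def Endo_inverse coord_shift[unfolded act_def])
  moreover have "((\<lambda>n. c * (coord a (n + k) / of_int (m - n))) has_sum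
      c * coord (act H_endo a) (m + k)) UNIV"
  proof (rule has_sum_cmult_right)
    show "((\<lambda>n. coord a (n + k) / of_int (m - n)) has_sum coord (act H_endo a) (m + k)) UNIV"
      using coord_H_has_sum[of a "m + k"]
      by (subst has_sum_reindex_bij_witness[where j = "\<lambda>n. n + k" and i = "\<lambda>n. n - k" and T = UNIV
            and h = "\<lambda>n. coord a n / of_int (m + k - n)"])
        (auto simp: act_def H_endo_def Endo_inverse)
  qed
  ultimately show "coord (act (H_endo * shift k c) a) m = coord (act (shift k c * H_endo) a) m"
    by (simp add: act_mult coord_shift has_sum_unique)
qed

lemma exp_shift_commute: "exp (t *\<^sub>R H_endo) * shift k c = shift k c * exp (t *\<^sub>R H_endo)"
proof -
  have "(\<lambda>n. (t *\<^sub>R H_endo) ^ n /\<^sub>R fact n * shift k c) sums (exp (t *\<^sub>R H_endo) * shift k c)"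
    by (intro sums_mult2 exp_converges)
  moreover have "(\<lambda>n. shift k c * ((t *\<^sub>R H_endo) ^ n /\<^sub>R fact n)) sums (shift k c * exp (t *\<^sub>R H_endo))"
    by (intro sums_mult exp_converges)
  ultimately show ?thesis
    using power_commuting_commutes[OF H_endo_shift_commute[of k c]]
    by (simp add: sums_iff)
qed

lemma coord_exp_delta0:
  "coord (act (exp (t *\<^sub>R H_endo)) delta0) m = of_real ((-1) powi m * sinc (t + of_int m))"
proof -
  have "(\<lambda>k. coord (act ((t *\<^sub>R H_endo) ^ k /\<^sub>R fact k) delta0) m) sums coord (act (exp (t *\<^sub>R H_endo)) delta0) m"
    by (intro bounded_linear.sums[OF bounded_linear_coord] bounded_linear.sums[OF bounded_linear_act_left]
        exp_converges)
  then have "(\<lambda>k. (t ^ k / fact k) *\<^sub>R mean (\<lambda>x. sawtooth x ^ k * cis (of_int m * x))) sums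
      coord (act (exp (t *\<^sub>R H_endo)) delta0) m"
    by (simp add: act_scaleR act_H_endo_power coord_scaleR coord_H_power_delta0 divide_inverse mult.commute)
  then show ?thesis
    using mean_exp_sawtooth_sums[of t m] by (simp only: sums_iff mean_exp_sawtooth_cis)
qed

lemma sinc_of_int: "sinc (of_int n) = (if n = 0 then 1 else 0)"
  by (simp add: sinc_def)

text \<open>
  The entries \<open>(-1)\<^sup>m sinc (k + m)\<close> of \<open>e\<^sup>k\<^sup>H \<delta>\<^sub>0\<close> vanish except at \<open>m = -k\<close>.
\<close>
lemma exp_int_H_endo: "exp (of_int k *\<^sub>R H_endo) = shift k ((-1) powi k)"
proof (rule shift_commutant_eqI)
  show "shift k ((-1) powi k) * shift j c = shift j c * shift k ((-1) powi k)" for j c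
    by (intro endo_eqI l2_eqI) (simp add: act_mult coord_shift ac_simps)
  show "act (exp (of_int k *\<^sub>R H_endo)) delta0 = act (shift k ((-1) powi k)) delta0"
  proof (rule l2_eqI)
    fix m
    have "sinc (of_int k + of_int m) = (if m + k = 0 then 1 else 0)"
      using sinc_of_int[of "k + m"] by (simp add: add.commute)
    moreover have "(-1) powi m = ((-1) powi k :: complex)" if "m + k = 0"
      using that by (simp add: power_int_minus_left eq_neg_iff_add_eq_0[symmetric])
    ultimately show "coord (act (exp (of_int k *\<^sub>R H_endo)) delta0) m = coord (act (shift k ((-1) powi k)) delta0) m"
      by (simp add: coord_exp_delta0 coord_shift coord_delta0)
  qed
qed (rule exp_shift_commute)

section \<open>Derivatives of the sinc function as matrix entries\<close>

lemma exp_H_endo_add: "exp ((s + t) *\<^sub>R H_endo) = exp (s *\<^sub>R H_endo) * exp (t *\<^sub>R H_endo)"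
  by (simp add: scaleR_add_left exp_add_commuting)

lemma coord_H_endo_power_exp_has_vector_derivative:
  "((\<lambda>t. coord (act (H_endo ^ r * exp (t *\<^sub>R H_endo)) v) m) has_vector_derivative
    coord (act (H_endo ^ Suc r * exp (t *\<^sub>R H_endo)) v) m) (at t)"
proof -
  have "bounded_linear (\<lambda>x. coord (act (H_endo ^ r * x) v) m)"
    by (intro bounded_linear_compose[OF bounded_linear_coord]
        bounded_linear_compose[OF bounded_linear_act_left] bounded_linear_mult_right)
  from bounded_linear.has_vector_derivative[OF this exp_scaleR_has_vector_derivative_left]
  show ?thesis by (simp add: mult.assoc power_Suc2 del: power_Suc)
qed

text \<open>
  The case \<open>r = 0\<close> is the entry of \<open>e\<^sup>t\<^sup>H\<close> computed above; each differentiation in \<open>t\<close> brings down a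
  factor \<open>H\<close>. In particular \<open>sinc\<close> is infinitely differentiable, including at its removable
  singularity.
\<close>
lemma derivs_sinc_eq_coord:
  "of_real ((deriv ^^ r) sinc t) = coord (act (H_endo ^ r * exp (t *\<^sub>R H_endo)) delta0) 0"
proof (induction r arbitrary: t)
  case 0
  show ?case by (simp add: coord_exp_delta0)
next
  case (Suc r)
  let ?c = "coord (act (H_endo ^ Suc r * exp (t *\<^sub>R H_endo)) delta0) 0"
  have D: "((\<lambda>t. complex_of_real ((deriv ^^ r) sinc t)) has_vector_derivative ?c) (at t)"
    unfolding Suc.IH by (rule coord_H_endo_power_exp_has_vector_derivative)
  have "((\<lambda>t. Re (complex_of_real ((deriv ^^ r) sinc t))) has_vector_derivative Re ?c) (at t)"
    by (rule bounded_linear.has_vector_derivative[OF bounded_linear_Re D])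
  then have "deriv ((deriv ^^ r) sinc) t = Re ?c"
    by (intro DERIV_imp_deriv) (simp add: has_real_derivative_iff_has_vector_derivative)
  moreover have "((\<lambda>t. Im (complex_of_real ((deriv ^^ r) sinc t))) has_vector_derivative Im ?c) (at t)"
    by (rule bounded_linear.has_vector_derivative[OF bounded_linear_Im D])
  \<comment> \<open>A real-valued function of \<open>t\<close> has a real derivative.\<close>
  then have "Im ?c = 0"
    using vector_derivative_unique_at[OF has_vector_derivative_const] by auto
  ultimately show ?case by (simp add: complex_eq_iff)
qed

lemma derivs_sinc_has_derivative:
  "((deriv ^^ r) sinc has_real_derivative (deriv ^^ Suc r) sinc t) (at t)"
  using bounded_linear.has_vector_derivative[OF bounded_linear_Re
      coord_H_endo_power_exp_has_vector_derivative[of r delta0 0 t]]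
  unfolding derivs_sinc_eq_coord[symmetric] Re_complex_of_real
  by (simp add: has_real_derivative_iff_has_vector_derivative del: funpow.simps)

lemma H_endo_power_shift_commute: "H_endo ^ r * shift k c = shift k c * H_endo ^ r"
  by (rule power_commuting_commutes[OF H_endo_shift_commute])

text \<open>
  Replacing \<open>t\<close> by \<open>t + m\<close> multiplies by \<open>e\<^sup>m\<^sup>H\<close>, a translation by \<open>m\<close> up to sign; so all entries
  follow from the one at \<open>0\<close>.
\<close>
lemma coord_H_endo_power_exp_delta0:
  "coord (act (H_endo ^ r * exp (t *\<^sub>R H_endo)) delta0) m
    = of_real ((-1) powi m * (deriv ^^ r) sinc (t + of_int m))"
proof -
  have "exp ((t + of_int m) *\<^sub>R H_endo) = exp ((of_int m + t) *\<^sub>R H_endo)"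
    by (simp add: add.commute)
  also have "H_endo ^ r * \<dots> = shift m ((-1) powi m) * (H_endo ^ r * exp (t *\<^sub>R H_endo))"
    by (simp add: exp_H_endo_add exp_int_H_endo H_endo_power_shift_commute flip: mult.assoc)
  finally have "of_real ((deriv ^^ r) sinc (t + of_int m))
      = (-1) powi m * coord (act (H_endo ^ r * exp (t *\<^sub>R H_endo)) delta0) m"
    by (simp add: derivs_sinc_eq_coord act_mult coord_shift)
  then show ?thesis
    by (simp add: flip: mult.assoc power_int_mult_distrib)
qed

lemma derivs_sinc_square_summable:
  "(\<lambda>k. ((deriv ^^ r) sinc (t - of_int k))\<^sup>2) summable_on UNIV"
proof -
  have "(\<lambda>m. ((deriv ^^ r) sinc (t + of_int m))\<^sup>2) summable_on UNIV"
    using cmod_square_summable[of "act (H_endo ^ r * exp (t *\<^sub>R H_endo)) delta0"]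
    by (simp add: coord_H_endo_power_exp_delta0 norm_mult norm_power_int)
  then show ?thesis
    by (subst summable_on_reindex_bij_witness[where j = uminus and i = uminus and T = UNIV
          and h = "\<lambda>m. ((deriv ^^ r) sinc (t + of_int m))\<^sup>2"]) auto
qed

text \<open>
  The series converges absolutely because the \<open>e\<^sup>k\<^sup>H\<close> are translations up to sign, hence contractions.
  At \<open>\<delta>\<^sub>0\<close> its \<open>m\<close>-th coordinate only sees the term \<open>k = -m\<close>, which matches the matrix entries of
  \<open>H\<^sup>r e\<^sup>t\<^sup>H\<close>.
\<close>
lemma H_endo_power_exp_has_sum:
  assumes "(\<lambda>k. \<bar>(deriv ^^ r) sinc (t - of_int k)\<bar>) summable_on UNIV"
  shows "((\<lambda>k. (deriv ^^ r) sinc (t - of_int k) *\<^sub>R exp (of_int k *\<^sub>R H_endo)) has_sum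
    H_endo ^ r * exp (t *\<^sub>R H_endo)) UNIV"
proof -
  define f where "f k = (deriv ^^ r) sinc (t - of_int k) *\<^sub>R exp (of_int k *\<^sub>R H_endo)" for k :: int
  have "f summable_on UNIV"
  proof (rule abs_summable_summable, rule Infinite_Sum.abs_summable_on_comparison_test'[OF assms])
    fix k
    have "norm (exp (of_int k *\<^sub>R H_endo)) \<le> 1"
      using norm_shift_le[of k "(-1) powi k"] by (simp add: exp_int_H_endo norm_power_int)
    then show "norm (f k) \<le> \<bar>(deriv ^^ r) sinc (t - of_int k)\<bar>"
      by (simp add: f_def mult_left_le)
  qed
  then have f: "(f has_sum infsum f UNIV) UNIV" by simp
  have "infsum f UNIV = H_endo ^ r * exp (t *\<^sub>R H_endo)"
  proof (rule shift_commutant_eqI)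
    show "H_endo ^ r * exp (t *\<^sub>R H_endo) * shift j c = shift j c * (H_endo ^ r * exp (t *\<^sub>R H_endo))" for j c
      by (metis H_endo_power_shift_commute exp_shift_commute mult.assoc)
    show "infsum f UNIV * shift j c = shift j c * infsum f UNIV" for j c
    proof -
      have "((\<lambda>k. f k * shift j c) has_sum infsum f UNIV * shift j c) UNIV"
        by (rule has_sum_bounded_linear[OF bounded_linear_mult_left f])
      moreover have "((\<lambda>k. shift j c * f k) has_sum shift j c * infsum f UNIV) UNIV"
        by (rule has_sum_bounded_linear[OF bounded_linear_mult_right f])
      ultimately show ?thesis
        by (simp add: f_def exp_shift_commute has_sum_unique)
    qed
    show "act (infsum f UNIV) delta0 = act (H_endo ^ r * exp (t *\<^sub>R H_endo)) delta0"
    proof (rule l2_eqI)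
      fix m
      have "((\<lambda>k. coord (act (f k) delta0) m) has_sum coord (act (infsum f UNIV) delta0) m) UNIV"
        by (rule has_sum_bounded_linear[OF
              bounded_linear_compose[OF bounded_linear_coord bounded_linear_act_left] f])
      moreover have "coord (act (f k) delta0) m
          = (if k = - m then coord (act (H_endo ^ r * exp (t *\<^sub>R H_endo)) delta0) m else 0)" for k
      proof -
        have "coord (act (f k) delta0) m
            = (deriv ^^ r) sinc (t - of_int k) *\<^sub>R ((-1) powi k * (if m + k = 0 then 1 else 0))"
          by (simp add: f_def act_scaleR coord_scaleR exp_int_H_endo coord_shift coord_delta0)
        moreover have "m + k = 0 \<longleftrightarrow> k = - m" by auto
        ultimately show ?thesis
          unfolding coord_H_endo_power_exp_delta0
          by (simp add: scaleR_conv_of_real mult.commute power_int_minus flip: power_int_inverse)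
      qed
      moreover have "((\<lambda>k. if k = - m then coord (act (H_endo ^ r * exp (t *\<^sub>R H_endo)) delta0) m else 0) has_sum
          coord (act (H_endo ^ r * exp (t *\<^sub>R H_endo)) delta0) m) UNIV"
        by (rule has_sum_finite_neutralI[where B = "{- m}"]) auto
      ultimately show "coord (act (infsum f UNIV) delta0) m = coord (act (H_endo ^ r * exp (t *\<^sub>R H_endo)) delta0) m"
        by (simp add: has_sum_unique)
    qed
  qed
  with f have "(f has_sum H_endo ^ r * exp (t *\<^sub>R H_endo)) UNIV" by simp
  then show ?thesis by (simp only: f_def[abs_def])
qed

lemma H_endo_power_has_sum:
  assumes "(\<lambda>k. \<bar>(deriv ^^ r) sinc (t - of_int k)\<bar>) summable_on UNIV"
  shows "((\<lambda>k. (deriv ^^ r) sinc (t - of_int k) *\<^sub>R exp ((of_int k - t) *\<^sub>R H_endo)) has_sum H_endo ^ r) UNIV"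
proof -
  have "((\<lambda>k. (deriv ^^ r) sinc (t - of_int k) *\<^sub>R exp (of_int k *\<^sub>R H_endo) * exp ((- t) *\<^sub>R H_endo)) has_sum
      H_endo ^ r * exp (t *\<^sub>R H_endo) * exp ((- t) *\<^sub>R H_endo)) UNIV"
    by (rule has_sum_bounded_linear[OF bounded_linear_mult_left H_endo_power_exp_has_sum[OF assms]])
  moreover have "exp (of_int k *\<^sub>R H_endo) * exp ((- t) *\<^sub>R H_endo) = exp ((of_int k - t) *\<^sub>R H_endo)" for k
    using exp_H_endo_add[of "of_int k" "- t"] by simp
  moreover have "exp (t *\<^sub>R H_endo) * exp ((- t) *\<^sub>R H_endo) = 1"
    using exp_H_endo_add[of t "- t"] by simp
  ultimately show ?thesis
    by (simp add: mult.assoc)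
qed

section \<open>Absolute summability of the coefficients\<close>

text \<open>
  Repeated differentiation of \<open>x sinc x = sin (\<pi> x) / \<pi>\<close>; differentiating a sine shifts its phase by
  \<open>\<pi> / 2\<close>.
\<close>
lemma derivs_sinc_recurrence:
  "x * (deriv ^^ Suc r) sinc x + real (Suc r) * (deriv ^^ r) sinc x
    = pi ^ r * sin (pi * x + real (Suc r) * (pi / 2))"
proof (induction r arbitrary: x)
  case 0
  have "((\<lambda>x. x * sinc x) has_real_derivative 1 * sinc x + x * deriv sinc x) (at x)"
    using derivs_sinc_has_derivative[of 0 x] by (auto intro!: derivative_eq_intros)
  moreover have "(\<lambda>x. x * sinc x) = (\<lambda>x. sin (pi * x) / pi)"
    by (auto simp: sinc_def fun_eq_iff)
  moreover have "((\<lambda>x. sin (pi * x) / pi) has_real_derivative cos (pi * x)) (at x)"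
    by (auto intro!: derivative_eq_intros)
  ultimately have "sinc x + x * deriv sinc x = cos (pi * x)"
    by (metis DERIV_unique mult_1)
  then show ?case by (simp add: sin_add)
next
  case (Suc r)
  let ?F = "\<lambda>r. (deriv ^^ r) sinc"
  have "((\<lambda>x. x * ?F (Suc r) x + real (Suc r) * ?F r x) has_real_derivative
      (x * ?F (Suc (Suc r)) x + 1 * ?F (Suc r) x) + real (Suc r) * ?F (Suc r) x) (at x)"
    by (auto intro!: derivative_eq_intros derivs_sinc_has_derivative simp del: funpow.simps)
  moreover have "((\<lambda>x. pi ^ r * sin (pi * x + real (Suc r) * (pi / 2))) has_real_derivative
      pi ^ Suc r * cos (pi * x + real (Suc r) * (pi / 2))) (at x)"
    by (auto intro!: derivative_eq_intros)
  ultimately have "(x * ?F (Suc (Suc r)) x + 1 * ?F (Suc r) x) + real (Suc r) * ?F (Suc r) x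
      = pi ^ Suc r * cos (pi * x + real (Suc r) * (pi / 2))"
    unfolding Suc by (rule DERIV_unique)
  moreover have "sin (pi * x + real (Suc (Suc r)) * (pi / 2)) = cos (pi * x + real (Suc r) * (pi / 2))"
  proof -
    have "pi * x + real (Suc (Suc r)) * (pi / 2) = pi * x + real (Suc r) * (pi / 2) + pi / 2"
      by (simp add: field_simps)
    then show ?thesis
      by (simp only: sin_add[of _ "pi / 2"] sin_pi_half cos_pi_half)
  qed
  ultimately show ?case
    by (simp only:) (simp add: algebra_simps del: funpow.simps)
qed

text \<open>
  By the recurrence the coefficients are products of the two square-summable sequences
  \<open>sinc\<^bsup>(r)\<^esup> (t - k)\<close> and \<open>1 / (t - k)\<close>, apart from the at most one index with \<open>t = k\<close>, where the
  recurrence gives nothing.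
\<close>
lemma derivs_sinc_abs_summable:
  assumes zero: "\<And>k::int. sin (pi * (t - of_int k) + real (Suc r) * (pi / 2)) = 0"
    and inv: "(\<lambda>k::int. (1 / (t - of_int k))\<^sup>2) summable_on UNIV"
  shows "(\<lambda>k::int. \<bar>(deriv ^^ Suc r) sinc (t - of_int k)\<bar>) summable_on UNIV"
proof -
  have "(\<lambda>k. real (Suc r) * \<bar>(deriv ^^ r) sinc (t - of_int k) * (1 / (t - of_int k))\<bar>) summable_on UNIV"
    by (intro summable_on_cmult_right summable_on_mult_square_summable inv derivs_sinc_square_summable)
  then have "(\<lambda>k. real (Suc r) * \<bar>(deriv ^^ r) sinc (t - of_int k) * (1 / (t - of_int k))\<bar>) summable_on {k. t - of_int k \<noteq> 0}"
    by (rule summable_on_subset_banach) simp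
  then have "(\<lambda>k. \<bar>(deriv ^^ Suc r) sinc (t - of_int k)\<bar>) summable_on {k. t - of_int k \<noteq> 0}"
  proof (rule summable_on_cong[THEN iffD1, rotated])
    fix k :: int assume k: "k \<in> {k. t - of_int k \<noteq> 0}"
    have "(t - of_int k) * (deriv ^^ Suc r) sinc (t - of_int k)
        = - (real (Suc r) * (deriv ^^ r) sinc (t - of_int k))"
      using derivs_sinc_recurrence[of "t - of_int k" r] zero[of k] by (simp del: funpow.simps)
    then have "(deriv ^^ Suc r) sinc (t - of_int k)
        = - (real (Suc r) * (deriv ^^ r) sinc (t - of_int k) / (t - of_int k))"
      using k by (simp add: field_simps del: funpow.simps)
    then show "real (Suc r) * \<bar>(deriv ^^ r) sinc (t - of_int k) * (1 / (t - of_int k))\<bar>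
        = \<bar>(deriv ^^ Suc r) sinc (t - of_int k)\<bar>"
      by (simp add: abs_mult del: funpow.simps)
  qed
  moreover have "(\<lambda>k. \<bar>(deriv ^^ Suc r) sinc (t - of_int k)\<bar>) summable_on {k. t - of_int k = 0}"
  proof (rule summable_on_finite)
    have "{k::int. t - of_int k = 0} \<subseteq> {\<lfloor>t\<rfloor>}" by auto
    then show "finite {k::int. t - of_int k = 0}" by (rule finite_subset) simp
  qed
  ultimately have "(\<lambda>k. \<bar>(deriv ^^ Suc r) sinc (t - of_int k)\<bar>) summable_on
      ({k. t - of_int k \<noteq> 0} \<union> {k. t - of_int k = 0})"
    by (intro summable_on_Un_disjoint) auto
  moreover have "{k. t - of_int k \<noteq> 0} \<union> {k. t - of_int k = 0} = (UNIV :: int set)" by auto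
  ultimately show ?thesis by simp
qed

text \<open>
  Square-summability of \<open>1 / (1/2 - k)\<close> comes for free: \<open>\<bar>sinc (1/2 - k)\<bar> = 1 / (\<pi> \<bar>1/2 - k\<bar>)\<close>, and
  the values of \<open>sinc\<close> are square-summable because they are, up to signs, the entries of
  \<open>e\<^bsup>H/2\<^esup> \<delta>\<^sub>0\<close>.
\<close>
lemma odd_derivs_sinc_abs_summable:
  "(\<lambda>k::int. \<bar>(deriv ^^ (2 * s + 1)) sinc (1 / 2 - of_int k)\<bar>) summable_on UNIV"
  unfolding Suc_eq_plus1[symmetric]
proof (rule derivs_sinc_abs_summable)
  fix k :: int
  have "pi * (1 / 2 - of_int k) + real (Suc (2 * s)) * (pi / 2) = pi * of_int (1 - k + int s)"
    by (simp add: algebra_simps)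
  then show "sin (pi * (1 / 2 - of_int k) + real (Suc (2 * s)) * (pi / 2)) = 0"
    by (simp only: sin_npi_int)
next
  have "(sinc (1 / 2 - of_int k))\<^sup>2 = (1 / pi)\<^sup>2 * (1 / (1 / 2 - of_int k))\<^sup>2" for k :: int
  proof -
    have ne: "1 / 2 - real_of_int k \<noteq> 0"
    proof
      assume "1 / 2 - real_of_int k = 0"
      then have "real_of_int (2 * k) = real_of_int 1" by simp
      then have "2 * k = 1" unfolding of_int_eq_iff .
      then show False by presburger
    qed
    have "(sin (pi * (1 / 2 - of_int k)))\<^sup>2 = 1"
      by (simp add: right_diff_distrib sin_diff cos_npi_int) 
    then show ?thesis using ne by (simp add: sinc_def power_divide power_mult_distrib)
  qed
  moreover have "(\<lambda>k. (sinc (1 / 2 - of_int k))\<^sup>2) summable_on UNIV"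
    using derivs_sinc_square_summable[of 0 "1 / 2"] by simp
  ultimately have "(\<lambda>k::int. (1 / pi)\<^sup>2 * (1 / (1 / 2 - real_of_int k))\<^sup>2) summable_on UNIV"
    by simp
  from summable_on_cmult_right[OF this, of "pi\<^sup>2"]
  show "(\<lambda>k::int. (1 / (1 / 2 - real_of_int k))\<^sup>2) summable_on UNIV"
    by (simp add: power_divide)
qed

lemma even_derivs_sinc_abs_summable:
  "(\<lambda>k::int. \<bar>(deriv ^^ (2 * s + 2)) sinc (0 - of_int k)\<bar>) summable_on UNIV"
  unfolding Suc_eq_plus1[symmetric] add_2_eq_Suc'
proof (rule derivs_sinc_abs_summable)
  fix k :: int
  have "pi * (0 - of_int k) + real (Suc (Suc (2 * s))) * (pi / 2) = pi * of_int (1 - k + int s)"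
    by (simp add: algebra_simps)
  then show "sin (pi * (0 - of_int k) + real (Suc (Suc (2 * s))) * (pi / 2)) = 0"
    by (simp only: sin_npi_int)
next
  show "(\<lambda>k::int. (1 / (0 - real_of_int k))\<^sup>2) summable_on UNIV"
    using inverse_square_int_has_sum by (auto simp: power_divide has_sum_imp_summable)
qed

section \<open>The interpolation formulas\<close>

lemma powi_sign_cancel: "(-1) powi k * ((-1) powi k * x) = (x::real)"
  by (simp flip: mult.assoc power_int_mult_distrib)

theorem theorem5p1:
  fixes a :: l2
  shows "(\<forall>r\<ge>1. blinfun_apply (blinfun_power H r) a = R_H r a) \<and>
    (\<forall>s\<ge>1. ((\<lambda>k::int. ((-1) powi (k + 1) * coeff_A s k) *\<^sub>R
        blinfun_apply (exp_H (real_of_int k - 1 / 2)) a)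
      has_sum blinfun_apply (blinfun_power H (2 * s - 1)) a) UNIV) \<and>
    (\<forall>s\<ge>1. ((\<lambda>k::int. ((-1) powi (k + 1) * coeff_B s k) *\<^sub>R
        blinfun_apply (exp_H (real_of_int k)) a)
      has_sum blinfun_apply (blinfun_power H (2 * s)) a) UNIV)"
proof -
  have gen: "((\<lambda>k. (deriv ^^ r) sinc (t - of_int k) *\<^sub>R blinfun_apply (exp_H (of_int k - t)) a) has_sum
      blinfun_apply (blinfun_power H r) a) UNIV"
    if "(\<lambda>k. \<bar>(deriv ^^ r) sinc (t - of_int k)\<bar>) summable_on UNIV" for r t
    using has_sum_bounded_linear[OF bounded_linear_act_left H_endo_power_has_sum[OF that], of a]
    by (simp add: act_scaleR act_H_endo_power) (simp add: act_def exp_H_eq)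
  have A: "((\<lambda>k::int. ((-1) powi (k + 1) * coeff_A s k) *\<^sub>R
        blinfun_apply (exp_H (real_of_int k - 1 / 2)) a)
      has_sum blinfun_apply (blinfun_power H (2 * s - 1)) a) UNIV" if "s \<ge> 1" for s
  proof -
    have "2 * s - 1 = 2 * (s - 1) + 1" using that by simp
    with gen[OF odd_derivs_sinc_abs_summable[of "s - 1"]] show ?thesis
      by (simp only: coeff_A_def powi_sign_cancel)
  qed
  have B: "((\<lambda>k::int. ((-1) powi (k + 1) * coeff_B s k) *\<^sub>R
        blinfun_apply (exp_H (real_of_int k)) a)
      has_sum blinfun_apply (blinfun_power H (2 * s)) a) UNIV" if "s \<ge> 1" for s
  proof -
    have "2 * s = 2 * (s - 1) + 2" using that by simp
    with gen[OF even_derivs_sinc_abs_summable[of "s - 1"]] show ?thesis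
      by (simp only: coeff_B_def powi_sign_cancel diff_0 diff_0_right)
  qed
  have "blinfun_apply (blinfun_power H r) a = R_H r a" if "r \<ge> 1" for r
  proof (cases "odd r")
    case True
    then have "2 * ((r + 1) div 2) - 1 = r" and "(r + 1) div 2 \<ge> 1" using that by presburger+
    with infsumI[OF A, of "(r + 1) div 2"] True show ?thesis by (simp add: R_H_def)
  next
    case False
    then have "2 * (r div 2) = r" and "r div 2 \<ge> 1" using that by presburger+
    with infsumI[OF B, of "r div 2"] False show ?thesis by (simp add: R_H_def)
  qed
  with A B show ?thesis by blast
qed

end
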